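(* Let $\ell\in\mathbb{N}^+$, let $2\le\eta\in\mathbb{N}^+$, let $\mathscr{B}$ be a Banach function space with the algebra property, let $\vartheta,\tilde\Delta_{\infty 1},\dots,\tilde\Delta_{\infty\ell}$ be approximation functions, let $F_j\in\mathscr{B}_{\tilde\Delta_{\infty j}}$ for $1\le j\le\ell$, and let $\rho_1,\dots,\rho_\ell\in\mathbb{T}^\infty$ satisfy the infinite-dimensional joint nonresonant condition with $\vartheta$ (discrete version for the discrete average, continuous version for the continuous average). Assume that for some integer $m\ge2$ $$\sum_{k^1,\dots,k^\ell\in\mathbb{Z}_*^\infty\setminus\{0\}}\frac{\vartheta^m\big(\sum_{j=1}^\ell|k^j|_\eta\big)}{\prod_{j=1}^\ell\tilde\Delta_{\infty j}(|k^j|_\eta)}<+\infty .$$ Then $$\Big\|\mathrm{DMW}_N^\ell(\mathcal F)(\theta)-\prod_{j=1}^\ell\Big(\int_{\mathbb{T}^\infty}F_j(\hat\theta)\,d\hat\theta\Big)\Big\|_{\mathscr B}=\mathcal{O}(N^{-m})$$ and $$\Big\|\mathrm{CMW}_T^\ell(\mathcal F)(\theta)-\prod_{j=1}^\ell\Big(\int_{\mathbb{T}^\infty}F_j(\hat\theta)\,d\hat\theta\Big)\Big\|_{\mathscr B}=\mathcal{O}(T^{-m})$$ whenever $N\in\mathbb N^+$ and $T>0$ are sufficiently large.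
   Context: Weight: $w(x)=\exp(-x^{-1}(1-x)^{-1})\big(\int_0^1\exp(-t^{-1}(1-t)^{-1})dt\big)^{-1}$ for $x\in(0,1)$ and $w(x)=0$ otherwise. Torus and rotations: $\mathbb{T}^\infty=\mathbb{T}^{\mathbb N}$ (with $0\in\mathbb N$), with the product probability measure; rotation vectors are taken in the cube $[1,2]^{\mathbb N}$, identified with $\mathbb{T}^\infty$. For $s\ge0$, $\mathscr{T}_\rho^s(\theta)=\theta+s\rho\bmod 1$ in each coordinate. Averages: with $A_N=\sum_{s=0}^{N-1}w(s/N)$, $$\mathrm{DMW}_N^\ell(\mathcal F)(\theta)=\frac1{A_N}\sum_{n=0}^{N-1}w(n/N)F_1(\mathscr{T}_{\rho_1}^n(\theta))\cdots F_\ell(\mathscr{T}_{\rho_\ell}^n(\theta)),$$ $$\mathrm{CMW}_T^\ell(\mathcal F)(\theta)=\frac1T\int_0^T w(s/T)F_1(\mathscr{T}_{\rho_1}^s(\theta))\cdots F_\ell(\mathscr{T}_{\rho_\ell}^s(\theta))\,ds .$$ Approximation function: a continuous, strictly increasing function $[1,+\infty)\to[1,+\infty)$ tending to $+\infty$ at $+\infty$. For $j\in\mathbb N$, $\langle j\rangle=\max\{1,|j|\}$; $\mathbb{Z}_*^\infty=\{k\in\mathbb{Z}^{\mathbb N}:|k|_\eta:=\sum_{j\in\mathbb N}\langle j\rangle^\eta|k_j|<+\infty\}$; $k\cdot\theta=\sum_j k_j\theta_j$. Infinite-dimensional joint nonresonant condition with $\vartheta$: write $\tilde\rho=(\rho_1,\dots,\rho_\ell)$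 and, for a joint integer vector $k=(k^1,\dots,k^\ell)$ with $k^j\in\mathbb{Z}_*^\infty$, $k\cdot\tilde\rho=\sum_{j}k^j\cdot\rho_j$ and $|k|_\eta=\sum_{j}|k^j|_\eta$. There is $\gamma>0$ such that, for all joint integer vectors $k\neq0$: in the discrete case, $|k\cdot\tilde\rho-n|>\gamma/\vartheta(|k|_\eta)$ for all $n\in\mathbb{Z}$; in the continuous case, $|k\cdot\tilde\rho|>\gamma/\vartheta(|k|_\eta)$. $(\mathscr B,\|\cdot\|_{\mathscr B})$ is a Banach (function) space with the algebra property (products of elements are in $\mathscr B$, with bounded multiplication). $\mathscr{B}_{\tilde\Delta_\infty}$ is the set of $f:\mathbb{T}^\infty\to\mathscr B$ with $f(\theta)=\sum_{k\in\mathbb{Z}_*^\infty}\hat f_k e^{2\pi i k\cdot\theta}$ (equality in the norm of $\mathscr B$), $\hat f_k=\int_{\mathbb{T}^\infty}f(\hat\theta)e^{-2\pi i k\cdot\hat\theta}d\hat\theta$, and $\sup_{0\ne k\in\mathbb{Z}_*^\infty}\tilde\Delta_\infty(|k|_\eta)\|\hat f_k\|_{\mathscr B}<+\infty$. Products of such functions are taken through multiplication in $\mathscr B$. $\mathcal{O}(\cdot)$ means bounded by a constant, independent of $N$ (resp. $T$), times the argument for all sufficiently large $N$ (resp. $T$). *)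

theory Defs
  imports "HOL-Analysis.Analysis"
begin

section \<open>Complex Banach spaces with the algebra property\<close>

text \<open>
  Multiplication is only required to be bounded, with an arbitrary constant; neither a unit nor
  commutativity is required.  Banach spaces of complex functions that are closed under pointwise
  products and have bounded multiplication are the intended instances.
\<close>

class cbanach_algebra = banach + ring +
  fixes scaleC :: "complex \<Rightarrow> 'a \<Rightarrow> 'a"  (infixr \<open>*\<^sub>C\<close> 75)
  assumes scaleC_add_right: "c *\<^sub>C (x + y) = c *\<^sub>C x + c *\<^sub>C y"
    and scaleC_add_left: "(c + d) *\<^sub>C x = c *\<^sub>C x + d *\<^sub>C x"
    and scaleC_scaleC: "c *\<^sub>C d *\<^sub>C x = (c * d) *\<^sub>C x"
    and scaleC_of_real: "complex_of_real r *\<^sub>C x = r *\<^sub>R x"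
    and norm_scaleC: "norm (c *\<^sub>C x) = cmod c * norm x"
    and mult_scaleC_left: "(c *\<^sub>C x) * y = c *\<^sub>C (x * y)"
    and mult_scaleC_right: "x * (c *\<^sub>C y) = c *\<^sub>C (x * y)"
    and ex_mult_bound: "\<exists>K. \<forall>x y. norm (x * y) \<le> K * norm x * norm y"

instantiation complex :: cbanach_algebra
begin

definition scaleC_complex :: "complex \<Rightarrow> complex \<Rightarrow> complex"
  where "scaleC_complex c x = c * x"

instance
proof
  show "\<exists>K. \<forall>x y :: complex. norm (x * y) \<le> K * norm x * norm y"
    by (rule exI[of _ 1]) (simp add: norm_mult)
qed (simp_all add: scaleC_complex_def algebra_simps norm_mult scaleR_conv_of_real)

end

text \<open>
  The product \<open>a 1 * \<dots> * a l\<close>.  As there need not be a unit, the value for \<open>l = 0\<close> is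
  meaningless; only \<open>l \<ge> 1\<close> is used.
\<close>

primrec seqprod :: "(nat \<Rightarrow> 'a::{times,zero}) \<Rightarrow> nat \<Rightarrow> 'a" where
  "seqprod a 0 = 0"
| "seqprod a (Suc l) = (if l = 0 then a (Suc 0) else seqprod a l * a (Suc l))"


section \<open>Bochner integral without a separability assumption\<close>

text \<open>
  The library's \<^const>\<open>has_bochner_integral\<close> is restricted to second countable ranges, which
  excludes many Banach function spaces.  In the following definition, the almost everywhere
  approximation by simple functions is strong measurability.
\<close>

definition strong_has_integral ::
    "'a measure \<Rightarrow> ('a \<Rightarrow> 'b::real_normed_vector) \<Rightarrow> 'b \<Rightarrow> bool" where
  "strong_has_integral M f x \<longleftrightarrow> (\<exists>s.
     (\<forall>i. Bochner_Integration.simple_bochner_integrable M (s i)) \<and>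
     (AE y in M. (\<lambda>i. s i y) \<longlonglongrightarrow> f y) \<and>
     (\<lambda>i. \<integral>\<^sup>+y. ennreal (norm (f y - s i y)) \<partial>M) \<longlonglongrightarrow> 0 \<and>
     (\<lambda>i. Bochner_Integration.simple_bochner_integral M (s i)) \<longlonglongrightarrow> x)"

definition strong_integrable :: "'a measure \<Rightarrow> ('a \<Rightarrow> 'b::real_normed_vector) \<Rightarrow> bool" where
  "strong_integrable M f \<longleftrightarrow> (\<exists>x. strong_has_integral M f x)"

definition strong_integral :: "'a measure \<Rightarrow> ('a \<Rightarrow> 'b::real_normed_vector) \<Rightarrow> 'b" where
  "strong_integral M f = (THE x. strong_has_integral M f x)"

lemma strong_has_integral_unique:
  assumes "strong_has_integral M f x" "strong_has_integral M f y"
  shows "x = y"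
proof -
  have meas: "\<exists>g\<in>borel_measurable M. AE z in M. ennreal (norm (f z - s i z)) = g z"
    if s: "\<forall>i. Bochner_Integration.simple_bochner_integrable M (s i)" and lim: "AE z in M. (\<lambda>i. s i z) \<longlonglongrightarrow> f z"
    for s :: "nat \<Rightarrow> 'a \<Rightarrow> 'b" and i
  proof -
    have 1: "(\<lambda>z. norm (s n z - s i z)) \<in> borel_measurable M" for n
      by (rule borel_measurable_simple_function, rule simple_function_compose2)
        (use s in \<open>auto elim: simple_bochner_integrable.cases\<close>)
    have "(\<lambda>z. lim (\<lambda>n. norm (s n z - s i z))) \<in> borel_measurable M"
      by (rule borel_measurable_lim_metric) (rule 1)
    moreover have "AE z in M. norm (f z - s i z) = lim (\<lambda>n. norm (s n z - s i z))"
      using lim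
    proof eventually_elim
      case (elim z)
      then have "(\<lambda>n. norm (s n z - s i z)) \<longlonglongrightarrow> norm (f z - s i z)"
        by (intro tendsto_intros)
      then show ?case by (simp add: limI)
    qed
    ultimately show ?thesis
      by (intro bexI[of _ "\<lambda>z. ennreal (lim (\<lambda>n. norm (s n z - s i z)))"]) auto
  qed
  obtain s where s: "\<forall>i. Bochner_Integration.simple_bochner_integrable M (s i)"
      "AE y in M. (\<lambda>i. s i y) \<longlonglongrightarrow> f y"
      "(\<lambda>i. \<integral>\<^sup>+y. ennreal (norm (f y - s i y)) \<partial>M) \<longlonglongrightarrow> 0"
      "(\<lambda>i. Bochner_Integration.simple_bochner_integral M (s i)) \<longlonglongrightarrow> x"
    using assms(1) unfolding strong_has_integral_def by blast
  obtain t where t: "\<forall>i. Bochner_Integration.simple_bochner_integrable M (t i)"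
      "AE y in M. (\<lambda>i. t i y) \<longlonglongrightarrow> f y"
      "(\<lambda>i. \<integral>\<^sup>+y. ennreal (norm (f y - t i y)) \<partial>M) \<longlonglongrightarrow> 0"
      "(\<lambda>i. Bochner_Integration.simple_bochner_integral M (t i)) \<longlonglongrightarrow> y"
    using assms(2) unfolding strong_has_integral_def by blast
  let ?S = "\<lambda>i. \<integral>\<^sup>+y. ennreal (norm (f y - s i y)) \<partial>M"
  let ?T = "\<lambda>i. \<integral>\<^sup>+y. ennreal (norm (f y - t i y)) \<partial>M"
  let ?s = "\<lambda>i. Bochner_Integration.simple_bochner_integral M (s i)"
  let ?t = "\<lambda>i. Bochner_Integration.simple_bochner_integral M (t i)"
  have bound: "ennreal (norm (?s i - ?t i)) \<le> ?S i + ?T i" for i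
  proof -
    have sb: "Bochner_Integration.simple_bochner_integrable M (\<lambda>z. s i z - t i z)"
      using s(1) t(1) by (auto intro: simple_bochner_integrable_compose2)
    have sbn: "Bochner_Integration.simple_bochner_integrable M (\<lambda>z. norm (s i z - t i z))"
      using s(1) t(1)
      by (auto intro: simple_bochner_integrable_compose2[where p = "\<lambda>a b. norm (a - b)"])
    obtain g where g: "g \<in> borel_measurable M" "AE z in M. ennreal (norm (f z - s i z)) = g z"
      using meas[OF s(1,2)] by blast
    obtain h where h: "h \<in> borel_measurable M" "AE z in M. ennreal (norm (f z - t i z)) = h z"
      using meas[OF t(1,2)] by blast
    have "?s i - ?t i = Bochner_Integration.simple_bochner_integral M (\<lambda>z. s i z - t i z)"
      using s(1) t(1) by (simp add: simple_bochner_integral_diff)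
    then have "norm (?s i - ?t i) \<le> Bochner_Integration.simple_bochner_integral M (\<lambda>z. norm (s i z - t i z))"
      using simple_bochner_integral_norm_bound[OF sb] by simp
    then have "ennreal (norm (?s i - ?t i)) \<le> (\<integral>\<^sup>+z. ennreal (norm (s i z - t i z)) \<partial>M)"
      using simple_bochner_integral_eq_nn_integral[OF sbn] by (metis ennreal_leI norm_ge_zero)
    also have "\<dots> \<le> (\<integral>\<^sup>+z. g z + h z \<partial>M)"
    proof (rule nn_integral_mono_AE)
      show "AE z in M. ennreal (norm (s i z - t i z)) \<le> g z + h z"
        using g(2) h(2)
      proof eventually_elim
        case (elim z)
        have "norm (s i z - t i z) \<le> norm (f z - s i z) + norm (f z - t i z)"
          by (metis norm_minus_commute norm_triangle_sub norm_diff_triangle_ineq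
              diff_add_cancel dist_norm dist_triangle2 dist_commute)
        then have "ennreal (norm (s i z - t i z))
            \<le> ennreal (norm (f z - s i z)) + ennreal (norm (f z - t i z))"
          by (simp flip: ennreal_plus add: ennreal_leI)
        then show ?case using elim by simp
      qed
    qed
    also have "\<dots> = (\<integral>\<^sup>+z. g z \<partial>M) + (\<integral>\<^sup>+z. h z \<partial>M)"
      by (rule nn_integral_add) (use g h in auto)
    also have "\<dots> = ?S i + ?T i"
      using nn_integral_cong_AE[OF g(2)] nn_integral_cong_AE[OF h(2)] by simp
    finally show ?thesis .
  qed
  have "(\<lambda>i. ennreal (norm (?s i - ?t i))) \<longlonglongrightarrow> ennreal 0"
  proof (rule tendsto_sandwich[where f = "\<lambda>_. 0" and h = "\<lambda>i. ?S i + ?T i"])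
    show "(\<lambda>i. ?S i + ?T i) \<longlonglongrightarrow> ennreal 0"
      using tendsto_add[OF s(3) t(3)] by simp
  qed (use bound in auto)
  then have "(\<lambda>i. norm (?s i - ?t i)) \<longlonglongrightarrow> 0"
    by (simp flip: ennreal_0)
  moreover have "(\<lambda>i. norm (?s i - ?t i)) \<longlonglongrightarrow> norm (x - y)"
    using s(4) t(4) by (intro tendsto_intros)
  ultimately have "norm (x - y) = 0"
    by (metis LIMSEQ_unique)
  then show ?thesis by simp
qed

lemma strong_integral_eq:
  "strong_has_integral M f x \<Longrightarrow> strong_integral M f = x"
  unfolding strong_integral_def by (blast intro: strong_has_integral_unique)


section \<open>The infinite-dimensional torus\<close>

text \<open>
  Points of the torus are represented by their coordinates in \<open>[0,1)\<close>, so the torus is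
  \<open>space torus\<close>.
\<close>

definition torus :: "(nat \<Rightarrow> real) measure" where
  "torus = PiM UNIV (\<lambda>_. restrict_space lborel {0..<1})"

definition rotation :: "(nat \<Rightarrow> real) \<Rightarrow> real \<Rightarrow> (nat \<Rightarrow> real) \<Rightarrow> (nat \<Rightarrow> real)" where
  "rotation \<rho> s \<theta> = (\<lambda>i. frac (\<theta> i + s * \<rho> i))"

definition angle :: "nat \<Rightarrow> real" where
  "angle i = max 1 (real i)"

definition Zstar :: "nat \<Rightarrow> (nat \<Rightarrow> int) set" where
  "Zstar \<eta> = {k. summable (\<lambda>i. angle i ^ \<eta> * \<bar>real_of_int (k i)\<bar>)}"

definition knorm :: "nat \<Rightarrow> (nat \<Rightarrow> int) \<Rightarrow> real" where
  "knorm \<eta> k = (\<Sum>i. angle i ^ \<eta> * \<bar>real_of_int (k i)\<bar>)"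

text \<open>Elements of \<^const>\<open>Zstar\<close> have finite support, so the following sum is a finite one.\<close>

definition kdot :: "(nat \<Rightarrow> int) \<Rightarrow> (nat \<Rightarrow> real) \<Rightarrow> real" where
  "kdot k \<theta> = (\<Sum>i. real_of_int (k i) * \<theta> i)"


section \<open>Approximation functions, nonresonance, regularity classes\<close>

definition approximation_function :: "(real \<Rightarrow> real) \<Rightarrow> bool" where
  "approximation_function \<Delta> \<longleftrightarrow>
     \<Delta> ` {1..} \<subseteq> {1..} \<and> continuous_on {1..} \<Delta> \<and> strict_mono_on {1..} \<Delta> \<and>
     filterlim \<Delta> at_top at_top"

text \<open>
  A joint vector \<open>(k\<^sup>1, \<dots>, k\<^sup>l)\<close> is a function on the index set \<open>{1..l}\<close>.
\<close>

definition joint_vectors :: "nat \<Rightarrow> nat \<Rightarrow> (nat \<Rightarrow> nat \<Rightarrow> int) set" where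
  "joint_vectors \<eta> l = (\<Pi>\<^sub>E j\<in>{1..l}. Zstar \<eta>)"

definition joint_norm :: "nat \<Rightarrow> nat \<Rightarrow> (nat \<Rightarrow> nat \<Rightarrow> int) \<Rightarrow> real" where
  "joint_norm \<eta> l k = (\<Sum>j=1..l. knorm \<eta> (k j))"

definition joint_dot :: "nat \<Rightarrow> (nat \<Rightarrow> nat \<Rightarrow> int) \<Rightarrow> (nat \<Rightarrow> nat \<Rightarrow> real) \<Rightarrow> real" where
  "joint_dot l k \<rho> = (\<Sum>j=1..l. kdot (k j) (\<rho> j))"

definition nonresonant_discrete ::
    "nat \<Rightarrow> (real \<Rightarrow> real) \<Rightarrow> nat \<Rightarrow> (nat \<Rightarrow> nat \<Rightarrow> real) \<Rightarrow> bool" where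
  "nonresonant_discrete \<eta> \<Theta> l \<rho> \<longleftrightarrow> (\<exists>\<gamma>>0. \<forall>k\<in>joint_vectors \<eta> l.
     (\<exists>j\<in>{1..l}. k j \<noteq> (\<lambda>_. 0)) \<longrightarrow>
       (\<forall>n::int. \<bar>joint_dot l k \<rho> - of_int n\<bar> > \<gamma> / \<Theta> (joint_norm \<eta> l k)))"

definition nonresonant_continuous ::
    "nat \<Rightarrow> (real \<Rightarrow> real) \<Rightarrow> nat \<Rightarrow> (nat \<Rightarrow> nat \<Rightarrow> real) \<Rightarrow> bool" where
  "nonresonant_continuous \<eta> \<Theta> l \<rho> \<longleftrightarrow> (\<exists>\<gamma>>0. \<forall>k\<in>joint_vectors \<eta> l.
     (\<exists>j\<in>{1..l}. k j \<noteq> (\<lambda>_. 0)) \<longrightarrow>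
       \<bar>joint_dot l k \<rho>\<bar> > \<gamma> / \<Theta> (joint_norm \<eta> l k))"

definition fourier_coeff :: "((nat \<Rightarrow> real) \<Rightarrow> 'b::cbanach_algebra) \<Rightarrow> (nat \<Rightarrow> int) \<Rightarrow> 'b" where
  "fourier_coeff f k = strong_integral torus (\<lambda>\<theta>. cis (- (2 * pi * kdot k \<theta>)) *\<^sub>C f \<theta>)"

text \<open>
  The index set of the Fourier series carries no canonical order, so the series is summed
  unconditionally.
\<close>

definition fourier_class ::
    "nat \<Rightarrow> (real \<Rightarrow> real) \<Rightarrow> ((nat \<Rightarrow> real) \<Rightarrow> 'b::cbanach_algebra) set" where
  "fourier_class \<eta> \<Delta> = {f.
     strong_integrable torus f \<and>
     (\<forall>\<theta>\<in>space torus.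
        ((\<lambda>k. cis (2 * pi * kdot k \<theta>) *\<^sub>C fourier_coeff f k) has_sum f \<theta>) (Zstar \<eta>)) \<and>
     bdd_above ((\<lambda>k. \<Delta> (knorm \<eta> k) * norm (fourier_coeff f k)) ` (Zstar \<eta> - {\<lambda>_. 0}))}"


section \<open>Weighted averages\<close>

definition weight :: "real \<Rightarrow> real" where
  "weight x =
     (if 0 < x \<and> x < 1
      then exp (- (inverse x * inverse (1 - x))) /
        integral {0<..<1} (\<lambda>t. exp (- (inverse t * inverse (1 - t))))
      else 0)"

definition DMW ::
    "nat \<Rightarrow> (nat \<Rightarrow> nat \<Rightarrow> real) \<Rightarrow> (nat \<Rightarrow> (nat \<Rightarrow> real) \<Rightarrow> 'b::cbanach_algebra) \<Rightarrow>
     nat \<Rightarrow> (nat \<Rightarrow> real) \<Rightarrow> 'b" where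
  "DMW l \<rho> F N \<theta> =
     inverse (\<Sum>s<N. weight (real s / real N)) *\<^sub>R
       (\<Sum>n<N. weight (real n / real N) *\<^sub>R seqprod (\<lambda>j. F j (rotation (\<rho> j) (real n) \<theta>)) l)"

text \<open>
  For functions with absolutely convergent Fourier series the integrand is continuous, so the
  Henstock-Kurzweil integral below is a Riemann integral.
\<close>

definition CMW ::
    "nat \<Rightarrow> (nat \<Rightarrow> nat \<Rightarrow> real) \<Rightarrow> (nat \<Rightarrow> (nat \<Rightarrow> real) \<Rightarrow> 'b::cbanach_algebra) \<Rightarrow>
     real \<Rightarrow> (nat \<Rightarrow> real) \<Rightarrow> 'b" where
  "CMW l \<rho> F T \<theta> =
     inverse T *\<^sub>R
       integral {0..T} (\<lambda>s. weight (s / T) *\<^sub>R seqprod (\<lambda>j. F j (rotation (\<rho> j) s \<theta>)) l)"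

end

theory Submission
  imports Defs
begin

text \<open>
  Multiplying out the Fourier series of the factors turns the product along an orbit into an
  absolutely convergent series of oscillations \<open>a\<^sub>k e^(2 \<pi> i k \<cdot> \<theta>) e^(2 \<pi> i s (k \<cdot> \<rho>))\<close>, indexed by joint
  frequencies \<open>k\<close> (\<open>orbit_has_sum\<close>).  A weighted average acts on such a series term by term: it
  multiplies the \<open>k\<close>-th term by a scalar kernel evaluated at \<open>k \<cdot> \<rho>\<close>.  The term for \<open>k = 0\<close> is the
  product of the means and is reproduced exactly, so the error is the sum of the other terms
  (\<open>multiplier_error_bound\<close>).

  The weight is smooth and all its derivatives vanish at the ends of its support
  (\<open>weight_derivatives\<close>).  Therefore \<open>m\<close> integrations by parts show that the continuous kernel at
  \<open>\<alpha>\<close> is \<open>O((T |\<alpha>|)^(-m))\<close> (\<open>continuous_kernel_bound\<close>), and \<open>m\<close> summations by parts give the same bound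
  for the discrete kernel, in terms of \<open>N\<close> and the distance of \<open>\<alpha>\<close> to the integers
  (\<open>discrete_kernel_bound\<close>).  In the discrete case this elementary argument replaces the Poisson
  summation formula.

  By nonresonance, the kernel at \<open>k \<cdot> \<rho>\<close> is then at most a constant times \<open>\<Theta>(|k|)^m N^(-m)\<close>, or
  \<open>\<Theta>(|k|)^m T^(-m)\<close>.  It remains to sum \<open>\<Theta>(|k|)^m\<close> against the norms of the coefficients, over all
  \<open>k \<noteq> 0\<close>.  The assumed series only runs over those \<open>k\<close> whose components are all nonzero; the
  other ones are reduced to these by filling vanishing components with a vector of norm \<open>1\<close>
  (\<open>summable_on_joint_vectors\<close>).  The same summability yields the absolute convergence of the
  single Fourier series (\<open>summable_joint_coeff\<close>), on which the multiplication of the series rests.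
\<close>

section \<open>Smoothness of the weight\<close>

text \<open>
  One term of the exponential series of \<open>z\<close> is at most the whole series.
\<close>

lemma power_mult_exp_minus_le: "z ^ n * exp (- z) \<le> fact n" if "0 \<le> z" for z :: real
proof -
  have "z ^ n / fact n \<le> (\<Sum>i. z ^ i /\<^sub>R fact i)"
  proof -
    have "(\<Sum>i\<in>{n}. z ^ i /\<^sub>R fact i) \<le> (\<Sum>i. z ^ i /\<^sub>R fact i)"
      by (rule sum_le_suminf) (use that summable_exp_generic[of z] in auto)
    then show ?thesis by (simp add: field_simps)
  qed
  then have "z ^ n \<le> fact n * exp z"
    by (simp add: exp_def field_simps)
  then show ?thesis by (simp add: exp_minus field_simps)
qed

text \<open>
  This is how smooth pieces are glued to the zero function at the endpoints of \<open>[0,1]\<close>, where no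
  closed formula for the derivative is available.
\<close>

lemma has_real_derivative_0_quadratic:
  fixes f :: "real \<Rightarrow> real"
  assumes "\<And>x. \<bar>f x\<bar> \<le> B * (x - a)\<^sup>2"
  shows "(f has_real_derivative 0) (at a)"
proof -
  have fa: "f a = 0" using assms[of a] by simp
  have "((\<lambda>x. (f x - f a) / (x - a)) \<longlongrightarrow> 0) (at a)"
  proof (rule Lim_null_comparison)
    show "\<forall>\<^sub>F x in at a. norm ((f x - f a) / (x - a)) \<le> B * \<bar>x - a\<bar>"
      unfolding eventually_at_filter
    proof (intro always_eventually allI impI)
      fix x assume "x \<noteq> a"
      then show "norm ((f x - f a) / (x - a)) \<le> B * \<bar>x - a\<bar>"
        using assms[of x] fa by (simp add: divide_le_eq power2_eq_square mult.assoc)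
    qed
    have "((\<lambda>x. B * \<bar>x - a\<bar>) \<longlongrightarrow> B * \<bar>a - a\<bar>) (at a)"
      by (intro tendsto_intros)
    then show "((\<lambda>x. B * \<bar>x - a\<bar>) \<longlongrightarrow> 0) (at a)" by simp
  qed
  then show ?thesis by (simp add: has_field_derivative_iff)
qed

text \<open>
  With \<open>z = 1 / (x (1 - x))\<close>, the weight is a multiple of \<open>exp (- z)\<close>.  Its derivatives all have the
  form \<open>p(x) z^n exp (- z)\<close> with a polynomial \<open>p\<close>, so this family makes all derivatives available
  at once, by a recursion on \<open>p\<close> and \<open>n\<close>.
\<close>

definition bump_term :: "real poly \<Rightarrow> nat \<Rightarrow> real \<Rightarrow> real" where
  "bump_term p n x =
     (if 0 < x \<and> x < 1
      then poly p x * inverse (x * (1 - x)) ^ n * exp (- inverse (x * (1 - x)))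
      else 0)"

text \<open>
  The derivative of \<open>p z^n exp (- z)\<close>, for \<open>z' = - (1 - 2x) z^2\<close>, with all summands brought to the
  common factor \<open>z^(n+2)\<close>; the powers of \<open>z\<close> missing in a summand appear as powers of \<open>x - x^2\<close>.
\<close>

definition bump_step :: "real poly \<Rightarrow> nat \<Rightarrow> real poly" where
  "bump_step p n = pderiv p * [:0, 1, -1:] ^ 2 - of_nat n * p * [:1, -2:] * [:0, 1, -1:]
     + p * [:1, -2:]"

text \<open>
  Two spare powers of \<open>z\<close> can be absorbed by the exponential, since \<open>z^(n+2) exp (- z)\<close> is bounded.
  The resulting quadratic vanishing at \<open>0\<close> and \<open>1\<close> gives differentiability there.
\<close>

lemma bump_term_quadratic:
  obtains B where "\<And>x. \<bar>bump_term p n x\<bar> \<le> B * (x * (1 - x))\<^sup>2" "B \<ge> 0"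
proof -
  have "bounded (poly p ` {0..1})"
    by (intro compact_imp_bounded compact_continuous_image continuous_intros compact_Icc)
  then obtain B0 where "\<forall>y\<in>poly p ` {0..1}. norm y \<le> B0"
    unfolding bounded_iff by blast
  then have B0: "\<bar>poly p x\<bar> \<le> B0" if "x \<in> {0..1}" for x
    using that by auto
  have B0_nonneg: "B0 \<ge> 0" using B0[of 0] by auto
  have "\<bar>bump_term p n x\<bar> \<le> (B0 * fact (n + 2)) * (x * (1 - x))\<^sup>2" for x
  proof (cases "0 < x \<and> x < 1")
    case True
    define s where "s = x * (1 - x)"
    have s: "s > 0" using True by (simp add: s_def)
    have "inverse s ^ n * exp (- inverse s) = (inverse s ^ (n + 2) * exp (- inverse s)) * s\<^sup>2"
      using s by (simp add: power_add power2_eq_square field_simps)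
    also have "\<dots> \<le> fact (n + 2) * s\<^sup>2"
      using s by (intro mult_right_mono power_mult_exp_minus_le) auto
    finally have 1: "inverse s ^ n * exp (- inverse s) \<le> fact (n + 2) * s\<^sup>2" .
    have "\<bar>bump_term p n x\<bar> = \<bar>poly p x\<bar> * (inverse s ^ n * exp (- inverse s))"
      using True s by (simp add: bump_term_def s_def abs_mult power_abs)
    also have "\<dots> \<le> B0 * (fact (n + 2) * s\<^sup>2)"
      by (intro mult_mono B0 1) (use True s B0_nonneg in auto)
    finally show ?thesis by (simp add: s_def mult.assoc)
  next
    case False
    then have "bump_term p n x = 0" by (auto simp: bump_term_def)
    then show ?thesis using B0_nonneg by simp
  qed
  then show ?thesis using B0_nonneg that[of "B0 * fact (n + 2)"] by simp
qed

text \<open>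
  Inside \<open>(0,1)\<close> this is the product rule; at the endpoints both sides vanish, the left one because
  of the quadratic bound; elsewhere the function is locally zero.
\<close>

lemma bump_term_has_derivative:
  "(bump_term p n has_real_derivative bump_term (bump_step p n) (n + 2) x) (at x)"
proof -
  obtain B where B: "\<And>x. \<bar>bump_term p n x\<bar> \<le> B * (x * (1 - x))\<^sup>2" "B \<ge> 0"
    using bump_term_quadratic by metis
  consider "0 < x \<and> x < 1" | "x = 0" | "x = 1" | "x < 0" | "x > 1" by linarith
  then show ?thesis
  proof cases
    case 1
    define s where "s = x * (1 - x)"
    have s: "s > 0" using 1 by (simp add: s_def)
    have "((\<lambda>x. poly p x * inverse (x * (1 - x)) ^ n * exp (- inverse (x * (1 - x))))
        has_real_derivative
          poly (pderiv p) x * inverse s ^ n * exp (- inverse s)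
          + poly p x * (of_nat n * inverse s ^ (n - 1) * (- (1 - 2 * x) * inverse s ^ 2)) * exp (- inverse s)
          + poly p x * inverse s ^ n * (exp (- inverse s) * ((1 - 2 * x) * inverse s ^ 2))) (at x)"
    proof -
      have i: "((\<lambda>x. inverse (x * (1 - x))) has_real_derivative - (1 - 2 * x) * inverse s ^ 2) (at x)"
      proof (rule DERIV_cong[OF DERIV_inverse'])
        show "((\<lambda>x. x * (1 - x)) has_real_derivative 1 - 2 * x) (at x)"
          by (auto intro!: derivative_eq_intros)
        show "- (inverse (x * (1 - x)) * (1 - 2 * x) * inverse (x * (1 - x)))
            = - (1 - 2 * x) * inverse s ^ 2"
          unfolding s_def[symmetric] by (simp add: power2_eq_square algebra_simps)
      qed (use 1 in simp)
      have n: "((\<lambda>x. inverse (x * (1 - x)) ^ n) has_real_derivative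
          of_nat n * inverse s ^ (n - 1) * (- (1 - 2 * x) * inverse s ^ 2)) (at x)"
        by (rule DERIV_cong[OF DERIV_power[OF i]]) (simp add: s_def)
      have e: "((\<lambda>x. exp (- inverse (x * (1 - x)))) has_real_derivative
          exp (- inverse s) * ((1 - 2 * x) * inverse s ^ 2)) (at x)"
        by (rule DERIV_cong[OF DERIV_fun_exp[OF DERIV_minus[OF i]]]) (simp add: s_def algebra_simps)
      show ?thesis
        by (rule DERIV_cong[OF DERIV_mult[OF DERIV_mult[OF poly_DERIV n] e]])
          (simp add: s_def algebra_simps)
    qed
    also have "poly (pderiv p) x * inverse s ^ n * exp (- inverse s)
          + poly p x * (of_nat n * inverse s ^ (n - 1) * (- (1 - 2 * x) * inverse s ^ 2)) * exp (- inverse s)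
          + poly p x * inverse s ^ n * (exp (- inverse s) * ((1 - 2 * x) * inverse s ^ 2))
        = bump_term (bump_step p n) (n + 2) x"
    proof -
      have a: "poly [:0, 1, -1:] x = s" "poly [:1, -2:] x = 1 - 2 * x"
        by (simp_all add: s_def algebra_simps)
      have b: "bump_term (bump_step p n) (n + 2) x =
          (poly (pderiv p) x * s\<^sup>2 - of_nat n * poly p x * (1 - 2 * x) * s + poly p x * (1 - 2 * x))
            * inverse s ^ (n + 2) * exp (- inverse s)"
        using 1 unfolding bump_term_def bump_step_def
        by (simp only: poly_add poly_diff poly_mult poly_power poly_of_nat a s_def[symmetric]) simp
      show ?thesis
      proof (cases n)
        case 0
        then show ?thesis unfolding b using s by (simp add: field_simps power2_eq_square)
      next
        case (Suc k)
        \<comment> \<open>With \<open>i = 1/s\<close> and \<open>X = i^k\<close>, the identity no longer contains symbolic exponents.\<close>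
        have alg: "a * (i * X) * e + b * (c * X * (- t * i\<^sup>2)) * e + b * (i * X) * (e * (t * i\<^sup>2))
            = (a * s\<^sup>2 - c * b * t * s + b * t) * (i ^ 3 * X) * e"
          if "s * i = 1" for a b c e i t X :: real
        proof -
          have "(a * s\<^sup>2 - c * b * t * s + b * t) * (i ^ 3 * X) * e
              = a * (s * i)\<^sup>2 * (i * X) * e - c * b * t * (s * i) * (i\<^sup>2 * X) * e + b * t * i ^ 3 * X * e"
            by (simp add: algebra_simps power2_eq_square power3_eq_cube)
          then show ?thesis
            using that by (simp add: algebra_simps power2_eq_square power3_eq_cube)
        qed
        have c: "inverse s ^ (n + 2) = inverse s ^ 3 * inverse s ^ k"
          by (simp add: Suc power_add mult_ac power2_eq_square power3_eq_cube)
        have d: "inverse s ^ n = inverse s * inverse s ^ k" "inverse s ^ (n - 1) = inverse s ^ k"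
          by (simp_all add: Suc)
        show ?thesis
          unfolding b c d by (rule alg) (use s in simp)
      qed
    qed
    finally have d: "((\<lambda>x. poly p x * inverse (x * (1 - x)) ^ n * exp (- inverse (x * (1 - x))))
        has_real_derivative bump_term (bump_step p n) (n + 2) x) (at x)" .
    show ?thesis
      by (rule has_field_derivative_transform_within_open[OF d, of "{0<..<1}"])
        (use 1 in \<open>auto simp: bump_term_def\<close>)
  next
    case 2
    have "\<bar>bump_term p n y\<bar> \<le> B * (y - 0)\<^sup>2" for y
    proof (cases "0 < y \<and> y < 1")
      case True
      have "(y * (1 - y))\<^sup>2 \<le> y\<^sup>2" using True by (intro power_mono) (auto simp: mult_le_cancel_left1)
      then show ?thesis using B(1)[of y] B(2) mult_left_mono[of "(y * (1 - y))\<^sup>2" "y\<^sup>2" B] by simp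
    qed (use B(2) in \<open>auto simp: bump_term_def\<close>)
    then have "(bump_term p n has_real_derivative 0) (at 0)"
      by (rule has_real_derivative_0_quadratic)
    then show ?thesis using 2 by (simp add: bump_term_def)
  next
    case 3
    have "\<bar>bump_term p n y\<bar> \<le> B * (y - 1)\<^sup>2" for y
    proof (cases "0 < y \<and> y < 1")
      case True
      have "(y * (1 - y))\<^sup>2 \<le> (1 - y)\<^sup>2" using True by (intro power_mono) (auto simp: mult_le_cancel_right2)
      then show ?thesis
        using B(1)[of y] B(2) mult_left_mono[of "(y * (1 - y))\<^sup>2" "(1 - y)\<^sup>2" B]
        by (simp add: power2_commute)
    qed (use B(2) in \<open>auto simp: bump_term_def\<close>)
    then have "(bump_term p n has_real_derivative 0) (at 1)"
      by (rule has_real_derivative_0_quadratic)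
    then show ?thesis using 3 by (simp add: bump_term_def)
  next
    case 4
    have "((\<lambda>_. 0) has_real_derivative 0) (at x)" by simp
    then have "(bump_term p n has_real_derivative 0) (at x)"
      by (rule has_field_derivative_transform_within_open[of _ _ _ "{..<0}"])
        (use 4 in \<open>auto simp: bump_term_def\<close>)
    then show ?thesis using 4 by (simp add: bump_term_def)
  next
    case 5
    have "((\<lambda>_. 0) has_real_derivative 0) (at x)" by simp
    then have "(bump_term p n has_real_derivative 0) (at x)"
      by (rule has_field_derivative_transform_within_open[of _ _ _ "{1<..}"])
        (use 5 in \<open>auto simp: bump_term_def\<close>)
    then show ?thesis using 5 by (simp add: bump_term_def)
  qed
qed

lemma bump_term_bounded: obtains B where "\<And>x. \<bar>bump_term p n x\<bar> \<le> B"
proof -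
  obtain B where B: "\<And>x. \<bar>bump_term p n x\<bar> \<le> B * (x * (1 - x))\<^sup>2" "B \<ge> 0"
    using bump_term_quadratic by metis
  have "\<bar>bump_term p n x\<bar> \<le> B" for x
  proof (cases "0 < x \<and> x < 1")
    case True
    have "(x * (1 - x))\<^sup>2 \<le> 1"
      using True by (intro power_le_one mult_le_one mult_nonneg_nonneg) auto
    then show ?thesis using B(1)[of x] B(2) mult_left_mono[of "(x * (1 - x))\<^sup>2" 1 B] by simp
  qed (use B(2) in \<open>auto simp: bump_term_def\<close>)
  then show ?thesis using that by blast
qed

lemma continuous_on_bump_term: "continuous_on A (bump_term p n)"
  by (meson bump_term_has_derivative DERIV_isCont continuous_at_imp_continuous_on)

abbreviation bump_mass :: real where
  "bump_mass \<equiv> integral {0..1} (bump_term 1 0)"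

lemma bump_mass_pos: "bump_mass > 0"
proof -
  have int: "bump_term 1 0 integrable_on {a..b}" for a b
    by (intro integrable_continuous_interval continuous_on_bump_term)
  have nn: "bump_term 1 0 x \<ge> 0" for x by (simp add: bump_term_def)
  have "bump_mass \<noteq> 0"
  proof
    assume "bump_mass = 0"
    then have "\<forall>x\<in>{0..1}. bump_term 1 0 x = 0"
      by (subst (asm) integral_eq_0_iff) (use nn continuous_on_bump_term in auto)
    then have "bump_term 1 0 (1/2) = 0" by auto
    then show False by (simp add: bump_term_def)
  qed
  moreover have "bump_mass \<ge> 0" by (intro integral_nonneg int) (use nn in auto)
  ultimately show ?thesis by simp
qed

lemma weight_eq_bump_term: "weight x = bump_term 1 0 x / bump_mass"
proof -
  have "integral {0<..<1} (\<lambda>t. exp (- (inverse t * inverse (1 - t)))) = integral {0<..<1} (bump_term 1 0)"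
    by (rule integral_cong) (auto simp: bump_term_def)
  also have "\<dots> = bump_mass" by (rule integral_open_interval_real[symmetric])
  finally show ?thesis by (simp add: weight_def bump_term_def)
qed

lemma weight_has_integral: "(weight has_integral 1) {0..1}"
proof -
  have "(bump_term 1 0 has_integral bump_mass) {0..1}"
    by (intro integrable_integral integrable_continuous_interval continuous_on_bump_term)
  then have "((\<lambda>x. bump_term 1 0 x / bump_mass) has_integral bump_mass / bump_mass) {0..1}"
    by (rule has_integral_divide)
  then show ?thesis using bump_mass_pos unfolding weight_eq_bump_term[abs_def] by simp
qed

text \<open>
  The rate of convergence rests on this property of the weight alone: differentiation allows any
  number of summations or integrations by parts, and vanishing at the ends removes the boundary terms.
\<close>

lemma weight_derivatives:
  obtains D where "D 0 = weight" "\<And>i x. (D i has_real_derivative D (Suc i) x) (at x)"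
    "\<And>i x. x \<le> 0 \<or> 1 \<le> x \<Longrightarrow> D i x = 0" "\<And>i::nat. \<exists>B. \<forall>x. \<bar>D i x\<bar> \<le> B"
proof -
  define P where "P = rec_nat (1::real poly) (\<lambda>i p. bump_step p (2 * i))"
  define D where "D i x = bump_term (P i) (2 * i) x / bump_mass" for i x
  show thesis
  proof (rule that[of D])
    show "D 0 = weight" by (simp add: fun_eq_iff D_def P_def weight_eq_bump_term)
    show "(D i has_real_derivative D (Suc i) x) (at x)" for i x
      using DERIV_cdivide[OF bump_term_has_derivative[of "P i" "2 * i" x], of bump_mass]
      by (simp add: D_def[abs_def] P_def)
    show "D i x = 0" if "x \<le> 0 \<or> 1 \<le> x" for i x
      using that by (auto simp: D_def bump_term_def)
    show "\<exists>B. \<forall>x. \<bar>D i x\<bar> \<le> B" for i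
    proof -
      obtain B where "\<And>x. \<bar>bump_term (P i) (2 * i) x\<bar> \<le> B" using bump_term_bounded by metis
      then have "\<forall>x. \<bar>D i x\<bar> \<le> B / bump_mass"
        using bump_mass_pos by (simp add: D_def divide_right_mono)
      then show ?thesis by blast
    qed
  qed
qed

lemma weight_nonneg: "weight x \<ge> 0"
  using bump_mass_pos by (simp add: weight_eq_bump_term bump_term_def)

lemma continuous_on_weight: "continuous_on A weight"
  unfolding weight_eq_bump_term[abs_def] using bump_mass_pos
  by (intro continuous_intros continuous_on_bump_term) simp_all

text \<open>
  On the middle third of the interval the weight is bounded below, and a fixed proportion of the
  nodes \<open>n / N\<close> lies there.  Hence division by the normalising sum gains a factor \<open>O(1/N)\<close>.
\<close>

lemma weight_sum_lower_bound:
  obtains c where "c > 0" "\<And>N. N \<ge> 3 \<Longrightarrow> c * real N \<le> (\<Sum>n<N. weight (real n / real N))"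
proof -
  define c0 where "c0 = exp (- (9/2)) / bump_mass"
  have c0: "c0 > 0" using bump_mass_pos by (simp add: c0_def)
  have low: "c0 \<le> weight x" if "1/3 \<le> x" "x \<le> 2/3" for x
  proof -
    have "0 \<le> (3 * x - 1) * (2 - 3 * x)" using that by simp
    then have "2/9 \<le> x * (1 - x)" by (simp add: algebra_simps)
    then have "inverse (x * (1 - x)) \<le> inverse (2/9)" by (intro le_imp_inverse_le) auto
    then have "exp (- (9/2)) \<le> exp (- inverse (x * (1 - x)))" by simp
    then show ?thesis using that bump_mass_pos
      by (simp add: weight_eq_bump_term bump_term_def c0_def divide_right_mono)
  qed
  have "c0 / 5 * real N \<le> (\<Sum>n<N. weight (real n / real N))" if "N \<ge> 3" for N
  proof -
    define q where "q = N div 3"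
    have q: "3 * q \<le> N" "N < 3 * q + 3" "q \<ge> 1" unfolding q_def using that by auto
    \<comment> \<open>As \<open>N \<ge> 3\<close>, the truncated third \<open>q\<close> still is at least \<open>N / 5\<close> (worst case \<open>N = 5\<close>).\<close>
    have "c0 / 5 * real N \<le> c0 * real q" using q c0 by (simp add: field_simps)
    also have "\<dots> = (\<Sum>n\<in>{q+1..2*q}. c0)" by simp
    also have "\<dots> \<le> (\<Sum>n\<in>{q+1..2*q}. weight (real n / real N))"
      by (rule sum_mono, rule low) (use q that in \<open>auto simp: field_simps\<close>)
    also have "\<dots> \<le> (\<Sum>n<N. weight (real n / real N))"
      by (rule sum_mono2) (use q weight_nonneg in auto)
    finally show ?thesis .
  qed
  then show ?thesis using that[of "c0 / 5"] c0 by simp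
qed

section \<open>Averages of a single oscillation\<close>

text \<open>
  Multiplying the sum by \<open>1 - z\<close> replaces the samples of \<open>D 0\<close> by their backward differences, without
  boundary terms because \<open>D 0\<close> vanishes at both ends.  After \<open>m\<close> such steps, the mean value theorem
  bounds each of the at most \<open>M + m\<close> remaining differences by \<open>B h^m\<close>.  The induction passes from
  \<open>D\<close> to its difference \<open>E\<close>, whose support is longer by one step.
\<close>

lemma summation_by_parts_bound:
  fixes D :: "nat \<Rightarrow> real \<Rightarrow> real" and z :: complex and h B :: real and M m :: nat
  assumes "cmod z = 1" "h > 0"
    and deriv: "\<And>i x. (D i has_real_derivative D (Suc i) x) (at x)"
    and "\<And>x. x \<le> 0 \<Longrightarrow> D 0 x = 0" "\<And>x. real M * h \<le> x \<Longrightarrow> D 0 x = 0"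
    and "\<And>x. \<bar>D m x\<bar> \<le> B"
  shows "cmod (1 - z) ^ m * cmod (\<Sum>n<M. of_real (D 0 (real n * h)) * z ^ n) \<le> real (M + m) * B * h ^ m"
  using assms(3-)
proof (induction m arbitrary: D M B)
  case 0
  have "cmod (\<Sum>n<M. of_real (D 0 (real n * h)) * z ^ n) \<le> (\<Sum>n<M. B)"
    by (rule sum_norm_le) (use 0(4) assms(1) in \<open>simp add: norm_mult norm_power\<close>)
  then show ?case by simp
next
  case (Suc m)
  define E where "E i x = D i x - D i (x - h)" for i x
  have parts: "(1 - z) * (\<Sum>n<M. of_real (D 0 (real n * h)) * z ^ n)
      = (\<Sum>n<Suc M. of_real (E 0 (real n * h)) * z ^ n)"
  proof -
    have "(\<Sum>n<Suc M. of_real (E 0 (real n * h)) * z ^ n)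
        = (\<Sum>n<Suc M. of_real (D 0 (real n * h)) * z ^ n)
          - (\<Sum>n<Suc M. of_real (D 0 (real n * h - h)) * z ^ n)"
      by (simp add: E_def algebra_simps sum_subtractf)
    also have "(\<Sum>n<Suc M. of_real (D 0 (real n * h)) * z ^ n)
        = (\<Sum>n<M. of_real (D 0 (real n * h)) * z ^ n)"
      using Suc.prems(3)[of "real M * h"] by simp
    also have "(\<Sum>n<Suc M. of_real (D 0 (real n * h - h)) * z ^ n)
        = z * (\<Sum>n<M. of_real (D 0 (real n * h)) * z ^ n)"
      using Suc.prems(2)[of "- h"] \<open>h > 0\<close>
      by (subst sum.lessThan_Suc_shift) (simp add: sum_distrib_left algebra_simps)
    finally show ?thesis by (simp add: algebra_simps)
  qed
  have "cmod (1 - z) ^ m * cmod (\<Sum>n<Suc M. of_real (E 0 (real n * h)) * z ^ n)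
      \<le> real (Suc M + m) * (h * B) * h ^ m"
  proof (rule Suc.IH)
    show "(E i has_real_derivative E (Suc i) x) (at x)" for i x
    proof -
      have "((\<lambda>x. D i (x - h)) has_real_derivative D (Suc i) (x - h)) (at x)"
        using DERIV_shift[of "D i" "D (Suc i) (x - h)" x "- h"] Suc.prems(1)[of i "x - h"] by simp
      then show ?thesis unfolding E_def[abs_def] using Suc.prems(1) by (intro derivative_intros)
    qed
    show "E 0 x = 0" if "x \<le> 0" for x
      using that Suc.prems(2) \<open>h > 0\<close> by (simp add: E_def)
    show "E 0 x = 0" if "real (Suc M) * h \<le> x" for x
    proof -
      have "real M * h \<le> x - h" "real M * h \<le> x" using that \<open>h > 0\<close> by (simp_all add: algebra_simps)
      then show ?thesis by (simp add: E_def Suc.prems(3))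
    qed
    show "\<bar>E m x\<bar> \<le> h * B" for x
    proof -
      obtain \<xi> where "E m x = h * D (Suc m) \<xi>"
        using MVT2[of "x - h" x "D m" "D (Suc m)"] Suc.prems(1) \<open>h > 0\<close> unfolding E_def by auto
      then show ?thesis using Suc.prems(4)[of \<xi>] \<open>h > 0\<close> by (simp add: abs_mult)
    qed
  qed
  moreover have "cmod (1 - z) ^ m * cmod (\<Sum>n<Suc M. of_real (E 0 (real n * h)) * z ^ n)
      = cmod (1 - z) ^ Suc m * cmod (\<Sum>n<M. of_real (D 0 (real n * h)) * z ^ n)"
    unfolding parts[symmetric] norm_mult by (simp only: power_Suc mult_ac)
  moreover have "real (Suc M + m) * (h * B) * h ^ m = real (M + Suc m) * B * h ^ Suc m"
    by (simp add: algebra_simps)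
  ultimately show ?case by (simp only:)
qed

lemma sin_ge_half: "x / 2 \<le> sin x" if "0 \<le> x" "x \<le> pi / 2" for x :: real
proof (cases "x = 0")
  case False
  have "cos (pi/4) \<le> cos t" if "0 \<le> t" "t \<le> x / 2" for t
    using that \<open>x \<le> pi / 2\<close> by (intro cos_monotone_0_pi_le) auto
  then have c: "sqrt 2 / 2 \<le> cos t" if "0 \<le> t" "t \<le> x / 2" for t
    using that by (simp add: cos_45)
  have "\<exists>t>0. t < x / 2 \<and> sin (x / 2) - sin 0 = (x / 2 - 0) * cos t"
    by (rule MVT2) (use False that in auto)
  then obtain t where t: "0 < t" "t < x / 2" "sin (x / 2) = x / 2 * cos t"
    by auto
  have "sqrt 2 / 2 * (x / 2) \<le> sin (x / 2)"
    unfolding t(3) using t c[of t] that by (subst mult.commute, intro mult_left_mono) auto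
  then have "(sqrt 2 / 2 * (x / 2)) * (sqrt 2 / 2) \<le> sin (x / 2) * cos (x / 2)"
    using c[of "x / 2"] that by (intro mult_mono) (auto intro: sin_ge_zero)
  then show ?thesis using sin_double[of "x / 2"] by (simp add: field_simps)
qed simp

text \<open>
  By periodicity \<open>\<alpha>\<close> can be reduced to \<open>[-1/2, 1/2]\<close>, and \<open>|1 - e^(2 \<pi> i \<beta>)| = 2 |sin (\<pi> \<beta>)|\<close>.
\<close>

lemma norm_one_minus_cis_ge:
  fixes \<alpha> \<delta> :: real
  assumes "\<And>n::int. \<bar>\<alpha> - of_int n\<bar> \<ge> \<delta>"
  shows "cmod (1 - cis (2 * pi * \<alpha>)) \<ge> \<delta>"
proof -
  define \<beta> where "\<beta> = \<alpha> - of_int (round \<alpha>)"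
  have b: "\<bar>\<beta>\<bar> \<le> 1 / 2" using of_int_round_abs_le[of \<alpha>] by (simp add: \<beta>_def abs_minus_commute)
  have "cis (2 * pi * \<alpha>) = cis (2 * pi * \<beta> + 2 * pi * of_int (round \<alpha>))"
    by (simp add: \<beta>_def algebra_simps)
  also have "\<dots> = cis (2 * pi * \<beta>)" by (simp add: cis_mult[symmetric] cis_multiple_2pi)
  finally have e: "cis (2 * pi * \<alpha>) = cis (2 * pi * \<beta>)" .
  have "(cmod (1 - cis (2 * pi * \<beta>)))\<^sup>2 = (1 - cos (2 * (pi * \<beta>)))\<^sup>2 + (sin (2 * (pi * \<beta>)))\<^sup>2"
    by (simp add: cmod_power2 mult.assoc)
  also have "\<dots> = (2 * sin (pi * \<beta>))\<^sup>2"
  proof -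
    have "(1 - (1 - 2 * a\<^sup>2))\<^sup>2 + (2 * a * b)\<^sup>2 = (2 * a)\<^sup>2 * (a\<^sup>2 + b\<^sup>2)" for a b :: real
      by (simp add: algebra_simps power2_eq_square)
    then show ?thesis
      unfolding cos_double_sin sin_double using sin_cos_squared_add[of "pi * \<beta>"] by simp
  qed
  also have "\<dots> = (2 * sin (pi * \<bar>\<beta>\<bar>))\<^sup>2" by (cases "\<beta> \<ge> 0") simp_all
  finally have "(cmod (1 - cis (2 * pi * \<beta>)))\<^sup>2 = (2 * sin (pi * \<bar>\<beta>\<bar>))\<^sup>2" .
  moreover have s: "pi * \<bar>\<beta>\<bar> / 2 \<le> sin (pi * \<bar>\<beta>\<bar>)"
    using mult_left_mono[OF b, of pi] by (intro sin_ge_half) simp_all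
  moreover have "0 \<le> pi * \<bar>\<beta>\<bar>" by simp
  then have "0 \<le> 2 * sin (pi * \<bar>\<beta>\<bar>)" using s by linarith
  ultimately have "cmod (1 - cis (2 * pi * \<beta>)) = 2 * sin (pi * \<bar>\<beta>\<bar>)"
    using power2_eq_imp_eq norm_ge_zero by blast
  then have "cmod (1 - cis (2 * pi * \<beta>)) \<ge> pi * \<bar>\<beta>\<bar>" using s by linarith
  moreover have "\<bar>\<beta>\<bar> \<ge> \<delta>" using assms[of "round \<alpha>"] by (simp add: \<beta>_def)
  moreover have "pi * \<bar>\<beta>\<bar> \<ge> 1 * \<bar>\<beta>\<bar>" using pi_ge_two by (intro mult_right_mono) auto
  ultimately show ?thesis by (simp add: e)
qed

text \<open>
  The weighted averages of the pure oscillation \<open>e^(2 \<pi> i s \<alpha>)\<close>: the Fourier multipliers by which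
  the discrete and the continuous average act on a mode of frequency \<open>\<alpha>\<close>.
\<close>

definition discrete_kernel :: "nat \<Rightarrow> real \<Rightarrow> complex" where
  "discrete_kernel N \<alpha> = inverse (\<Sum>s<N. weight (real s / real N)) *\<^sub>R
     (\<Sum>n<N. weight (real n / real N) *\<^sub>R cis (2 * pi * (real n * \<alpha>)))"

definition continuous_kernel :: "real \<Rightarrow> real \<Rightarrow> complex" where
  "continuous_kernel T \<alpha> = inverse T *\<^sub>R
     integral {0..T} (\<lambda>s. weight (s / T) *\<^sub>R cis (2 * pi * (s * \<alpha>)))"

lemma discrete_kernel_0: "discrete_kernel N 0 = 1" if "N \<ge> 3"
proof -
  obtain c where c: "c > 0" "\<And>N. N \<ge> 3 \<Longrightarrow> c * real N \<le> (\<Sum>n<N. weight (real n / real N))"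
    using weight_sum_lower_bound by metis
  have "c * real N > 0" using c that by simp
  then have "(\<Sum>n<N. weight (real n / real N)) \<noteq> 0" using c(2)[OF that] by linarith
  then show ?thesis
    by (simp add: discrete_kernel_def scaleR_sum_left[symmetric])
qed

text \<open>
  Summation by parts bounds the unnormalised sum by a multiple of \<open>N\<close> times the claimed bound, and
  the normalising sum, which is at least a multiple of \<open>N\<close>, removes that factor.
\<close>

lemma discrete_kernel_bound:
  obtains C where "C \<ge> 0"
    "\<And>N \<alpha> \<delta>. N \<ge> 3 \<Longrightarrow> \<delta> > 0 \<Longrightarrow> (\<And>n::int. \<bar>\<alpha> - of_int n\<bar> \<ge> \<delta>) \<Longrightarrow>
       cmod (discrete_kernel N \<alpha>) \<le> C / real N ^ m * (1 / \<delta>) ^ m"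
proof -
  obtain c where c: "c > 0" "\<And>N. N \<ge> 3 \<Longrightarrow> c * real N \<le> (\<Sum>n<N. weight (real n / real N))"
    using weight_sum_lower_bound by metis
  obtain D where D: "D 0 = weight" "\<And>i x. (D i has_real_derivative D (Suc i) x) (at x)"
    "\<And>i x. x \<le> 0 \<or> 1 \<le> x \<Longrightarrow> D i x = 0" "\<And>i::nat. \<exists>B. \<forall>x. \<bar>D i x\<bar> \<le> B"
    using weight_derivatives by metis
  obtain B where B: "\<And>x. \<bar>D m x\<bar> \<le> B" using D(4) by metis
  have "B \<ge> 0" using B[of 0] by simp
  define C where "C = (real m + 1) * B / c"
  have "cmod (discrete_kernel N \<alpha>) \<le> C / real N ^ m * (1 / \<delta>) ^ m"
    if N: "N \<ge> 3" and "\<delta> > 0" and \<alpha>: "\<And>n::int. \<bar>\<alpha> - of_int n\<bar> \<ge> \<delta>" for N \<alpha> \<delta>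
  proof -
    define z where "z = cis (2 * pi * \<alpha>)"
    define A where "A = (\<Sum>n<N. weight (real n / real N))"
    define S where "S = (\<Sum>n<N. of_real (D 0 (real n * (1 / real N))) * z ^ n)"
    have A: "c * real N \<le> A" "A > 0"
      using c N by (auto simp: A_def intro: less_le_trans[of 0 "c * real N"])
    have "cmod (1 - z) ^ m * cmod S \<le> real (N + m) * B * (1 / real N) ^ m"
      unfolding S_def
      by (rule summation_by_parts_bound) (use N D(2,3) B in \<open>auto simp: z_def\<close>)
    moreover have "\<delta> ^ m * cmod S \<le> cmod (1 - z) ^ m * cmod S"
      using norm_one_minus_cis_ge[OF \<alpha>] \<open>\<delta> > 0\<close>
      by (intro mult_right_mono power_mono) (auto simp: z_def)
    moreover have "real (N + m) * B * (1 / real N) ^ m \<le> ((real m + 1) * real N) * B * (1 / real N) ^ m"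
    proof (intro mult_right_mono)
      have "real m * 1 \<le> real m * real N" using N by (intro mult_left_mono) auto
      then show "real (N + m) \<le> (real m + 1) * real N" by (simp add: algebra_simps)
    qed (use \<open>B \<ge> 0\<close> in auto)
    ultimately have "\<delta> ^ m * cmod S \<le> ((real m + 1) * real N) * B * (1 / real N) ^ m" by linarith
    then have "(\<delta> ^ m * cmod S) * (1 / \<delta>) ^ m \<le> ((real m + 1) * real N) * B * (1 / real N) ^ m * (1 / \<delta>) ^ m"
      using \<open>\<delta> > 0\<close> by (intro mult_right_mono) auto
    moreover have "(\<delta> ^ m * cmod S) * (1 / \<delta>) ^ m = cmod S"
      using \<open>\<delta> > 0\<close> by (simp add: power_one_over)
    ultimately have S: "cmod S \<le> ((real m + 1) * real N) * B * (1 / real N) ^ m * (1 / \<delta>) ^ m"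
      by (simp only:)
    have "discrete_kernel N \<alpha> = inverse A *\<^sub>R S"
      by (simp add: discrete_kernel_def A_def S_def D(1) z_def Complex.DeMoivre scaleR_conv_of_real
          mult.left_commute mult.assoc)
    then have "cmod (discrete_kernel N \<alpha>) = cmod S / A" using A by (simp add: divide_inverse)
    also have "\<dots> \<le> (((real m + 1) * real N) * B * (1 / real N) ^ m * (1 / \<delta>) ^ m) / (c * real N)"
      using S A c N \<open>B \<ge> 0\<close> \<open>\<delta> > 0\<close> by (intro frac_le) auto
    also have "\<dots> = C / real N ^ m * (1 / \<delta>) ^ m"
    proof -
      have "(a * n) * B * x * y / (c * n) = (a * B / c) * x * y" if "n \<noteq> 0" for a n x y :: real
        using that by simp
      from this[of "real N"] show ?thesis
        using N by (simp add: C_def power_one_over)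
    qed
    finally show ?thesis .
  qed
  then show ?thesis using that[of C] \<open>B \<ge> 0\<close> c by (simp add: C_def)
qed

text \<open>
  The integral of the weight is \<open>1\<close>; rescaling by \<open>T\<close> does the rest.
\<close>

lemma continuous_kernel_0: "continuous_kernel T 0 = 1" if "T > 0"
proof -
  have "((\<lambda>s. weight ((1 / T) *\<^sub>R s + 0)) has_integral (1 /\<^sub>R (1 / T) ^ DIM(real)))
      (cbox ((0 - 0) /\<^sub>R (1 / T)) ((1 - 0) /\<^sub>R (1 / T)))"
    using weight_has_integral that by (intro has_integral_affinity') (auto simp: cbox_interval)
  then have "((\<lambda>s. weight (s / T)) has_integral T) {0..T}" using that by simp
  then have "((\<lambda>s. weight (s / T) *\<^sub>R (1::complex)) has_integral T *\<^sub>R 1) {0..T}"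
    by (rule has_integral_scaleR_left)
  then show ?thesis using that by (simp add: continuous_kernel_def integral_unique)
qed

text \<open>
  Each integration by parts gains a factor \<open>1 / (2 \<pi> \<alpha> T)\<close> and moves one derivative onto the
  weight; no boundary terms occur since all derivatives vanish at \<open>0\<close> and \<open>1\<close>.
\<close>

lemma continuous_kernel_bound:
  obtains C where "C \<ge> 0"
    "\<And>T \<alpha> \<delta>. T > 0 \<Longrightarrow> \<delta> > 0 \<Longrightarrow> \<bar>\<alpha>\<bar> \<ge> \<delta> \<Longrightarrow>
       cmod (continuous_kernel T \<alpha>) \<le> C / T ^ m * (1 / \<delta>) ^ m"
proof -
  obtain D where D: "D 0 = weight" "\<And>i x. (D i has_real_derivative D (Suc i) x) (at x)"
    "\<And>i x. x \<le> 0 \<or> 1 \<le> x \<Longrightarrow> D i x = 0" "\<And>i::nat. \<exists>B. \<forall>x. \<bar>D i x\<bar> \<le> B"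
    using weight_derivatives by metis
  obtain B where B: "\<And>x. \<bar>D m x\<bar> \<le> B" using D(4) by metis
  have B0: "B \<ge> 0" using B[of 0] by simp
  have "cmod (continuous_kernel T \<alpha>) \<le> B / T ^ m * (1 / \<delta>) ^ m"
    if T: "T > 0" and "\<delta> > 0" and \<alpha>: "\<bar>\<alpha>\<bar> \<ge> \<delta>" for T \<alpha> \<delta>
  proof -
    define e where "e s = cis (2 * pi * (s * \<alpha>))" for s
    define J where "J i = integral {0..T} (\<lambda>s. D i (s / T) *\<^sub>R e s)" for i
    have contD: "continuous_on A (\<lambda>s. D i (s / T))" for A i
    proof (rule continuous_on_compose2[of UNIV "D i"])
      show "continuous_on UNIV (D i)"
        using D(2) by (meson DERIV_isCont continuous_at_imp_continuous_on)
    qed (use T in \<open>auto intro!: continuous_intros\<close>)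
    have conte: "continuous_on A e" for A
      unfolding e_def by (intro continuous_intros)
    have int: "(\<lambda>s. D i (s / T) *\<^sub>R e s) integrable_on {0..T}" for i
      by (intro integrable_continuous_interval continuous_intros contD conte)
    have step: "(2 * pi * \<alpha> * T) *\<^sub>R (\<i> * J i) = - J (Suc i)" for i
    proof -
      have "((\<lambda>s. D i (s / T) *\<^sub>R e s) has_vector_derivative
          D i (s / T) *\<^sub>R ((2 * pi * \<alpha>) *\<^sub>R (\<i> * e s)) + (D (Suc i) (s / T) / T) *\<^sub>R e s) (at s within {0..T})" for s
      proof (rule has_vector_derivative_scaleR)
        have "(D i \<circ> (\<lambda>s. s / T) has_real_derivative D (Suc i) (s / T) * (1 / T)) (at s)"
          by (rule DERIV_chain[OF D(2)]) (use T in \<open>auto intro!: derivative_eq_intros\<close>)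
        then show "((\<lambda>s. D i (s / T)) has_field_derivative D (Suc i) (s / T) / T) (at s within {0..T})"
          by (auto simp: o_def intro: has_field_derivative_at_within)
        have "((\<lambda>s. complex_of_real (2 * pi * (s * \<alpha>)) * \<i>) has_vector_derivative complex_of_real (2 * pi * \<alpha>) * \<i>) (at s)"
          unfolding has_vector_derivative_def
          by (auto intro!: derivative_eq_intros simp: scaleR_conv_of_real algebra_simps)
        then have "((exp \<circ> (\<lambda>s. complex_of_real (2 * pi * (s * \<alpha>)) * \<i>)) has_vector_derivative
            (complex_of_real (2 * pi * \<alpha>) * \<i>) * exp (complex_of_real (2 * pi * (s * \<alpha>)) * \<i>)) (at s)"
          by (rule field_vector_diff_chain_at) (rule DERIV_exp)
        then show "(e has_vector_derivative (2 * pi * \<alpha>) *\<^sub>R (\<i> * e s)) (at s within {0..T})"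
          by (auto simp: o_def e_def[abs_def] cis_conv_exp scaleR_conv_of_real mult_ac
              intro: has_vector_derivative_at_within)
      qed
      then have "((\<lambda>s. D i (s / T) *\<^sub>R ((2 * pi * \<alpha>) *\<^sub>R (\<i> * e s)) + (D (Suc i) (s / T) / T) *\<^sub>R e s)
          has_integral D i (T / T) *\<^sub>R e T - D i (0 / T) *\<^sub>R e 0) {0..T}"
        using T by (intro fundamental_theorem_of_calculus) auto
      then have 1: "((\<lambda>s. D i (s / T) *\<^sub>R ((2 * pi * \<alpha>) *\<^sub>R (\<i> * e s)) + (D (Suc i) (s / T) / T) *\<^sub>R e s)
          has_integral 0) {0..T}"
        using T D(3)[of 0 i] D(3)[of 1 i] by simp
      have "((\<lambda>s. (2 * pi * \<alpha>) *\<^sub>R (\<i> * (D i (s / T) *\<^sub>R e s)) + (1 / T) *\<^sub>R (D (Suc i) (s / T) *\<^sub>R e s))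
          has_integral (2 * pi * \<alpha>) *\<^sub>R (\<i> * J i) + (1 / T) *\<^sub>R J (Suc i)) {0..T}"
        unfolding J_def
        by (intro has_integral_add has_integral_cmul has_integral_mult_right integrable_integral int)

      also have "(\<lambda>s. (2 * pi * \<alpha>) *\<^sub>R (\<i> * (D i (s / T) *\<^sub>R e s)) + (1 / T) *\<^sub>R (D (Suc i) (s / T) *\<^sub>R e s))
          = (\<lambda>s. D i (s / T) *\<^sub>R ((2 * pi * \<alpha>) *\<^sub>R (\<i> * e s)) + (D (Suc i) (s / T) / T) *\<^sub>R e s)"
        by (simp add: fun_eq_iff scaleR_conv_of_real algebra_simps)
      finally have "(2 * pi * \<alpha>) *\<^sub>R (\<i> * J i) + (1 / T) *\<^sub>R J (Suc i) = 0"
        using 1 has_integral_unique by blast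
      then have "T *\<^sub>R ((2 * pi * \<alpha>) *\<^sub>R (\<i> * J i) + (1 / T) *\<^sub>R J (Suc i)) = 0" by simp
      then show ?thesis using T by (simp add: scaleR_add_right mult.commute eq_neg_iff_add_eq_0)
    qed
    have "(\<delta> * T) ^ i * cmod (J 0) \<le> cmod (J i)" for i
    proof (induction i)
      case (Suc i)
      have "cmod (J (Suc i)) = cmod ((2 * pi * \<alpha> * T) *\<^sub>R (\<i> * J i))" by (simp only: step norm_minus_cancel)
      also have "\<dots> = (2 * pi * \<bar>\<alpha>\<bar> * T) * cmod (J i)" using T by (simp add: norm_mult abs_mult)
      also have "\<dots> \<ge> (\<delta> * T) * cmod (J i)"
      proof (intro mult_right_mono)
        have "1 * \<bar>\<alpha>\<bar> \<le> 2 * pi * \<bar>\<alpha>\<bar>" using pi_ge_two by (intro mult_right_mono) auto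
        then show "\<delta> \<le> 2 * pi * \<bar>\<alpha>\<bar>" using \<alpha> by simp
      qed (use T in auto)
      moreover have "(\<delta> * T) * ((\<delta> * T) ^ i * cmod (J 0)) \<le> (\<delta> * T) * cmod (J i)"
        using Suc T \<open>\<delta> > 0\<close> by (intro mult_left_mono) auto
      ultimately show ?case by (simp add: mult.assoc)
    qed simp
    moreover have "cmod (J m) \<le> B * (T - 0)"
      unfolding J_def
      by (rule integral_bound) (use T B in \<open>auto intro!: continuous_intros contD conte simp: e_def\<close>)
    ultimately have "(\<delta> * T) ^ m * cmod (J 0) \<le> B * T" by (metis diff_zero order_trans)
    then have "cmod (J 0) / T \<le> B / T ^ m * (1 / \<delta>) ^ m"
      using T \<open>\<delta> > 0\<close> by (simp add: field_simps)
    moreover have "cmod (continuous_kernel T \<alpha>) = cmod (J 0) / T"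
      using T by (simp add: continuous_kernel_def J_def D(1) e_def divide_inverse_commute)
    ultimately show ?thesis by simp
  qed
  then show ?thesis using that[of B] B0 by simp
qed

section \<open>Series in a Banach space with bounded multiplication\<close>

lemma bounded_bilinear_scaleC:
  "bounded_bilinear (scaleC :: complex \<Rightarrow> 'b \<Rightarrow> 'b::cbanach_algebra)"
proof
  fix r :: real and c :: complex and x :: 'b
  have "complex_of_real r *\<^sub>C c *\<^sub>C x = (complex_of_real r * c) *\<^sub>C x" by (rule scaleC_scaleC)
  then show "(r *\<^sub>R c) *\<^sub>C x = r *\<^sub>R (c *\<^sub>C x)"
    by (simp add: scaleC_of_real scaleR_conv_of_real)
  have "c *\<^sub>C complex_of_real r *\<^sub>C x = complex_of_real r *\<^sub>C c *\<^sub>C x"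
    by (simp only: scaleC_scaleC mult.commute)
  then show "c *\<^sub>C (r *\<^sub>R x) = r *\<^sub>R (c *\<^sub>C x)" by (simp add: scaleC_of_real)
  show "\<exists>K. \<forall>c (x::'b). norm (c *\<^sub>C x) \<le> cmod c * norm x * K"
    by (rule exI[of _ 1]) (simp add: norm_scaleC)
qed (simp_all add: scaleC_add_left scaleC_add_right)

lemma bounded_bilinear_times:
  "bounded_bilinear ((*) :: 'b \<Rightarrow> 'b \<Rightarrow> 'b::cbanach_algebra)"
proof
  fix r :: real and x y :: 'b
  show "(r *\<^sub>R x) * y = r *\<^sub>R (x * y)" "x * (r *\<^sub>R y) = r *\<^sub>R (x * y)"
    by (simp_all add: scaleC_of_real[symmetric] mult_scaleC_left mult_scaleC_right)
  show "\<exists>K. \<forall>x y::'b. norm (x * y) \<le> norm x * norm y * K"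
    using ex_mult_bound by (metis mult.assoc mult.commute)
qed (simp_all add: distrib_left distrib_right)

lemma scaleC_one: "1 *\<^sub>C x = (x :: 'b::cbanach_algebra)"
  using scaleC_of_real[of 1 x] by simp

lemma seqprod_cong: "seqprod a l = seqprod b l" if "\<And>j. j \<in> {1..l} \<Longrightarrow> a j = b j"
  using that by (induction l) (auto split: if_splits)

text \<open>
  Scalars commute with everything, although the elements \<open>x j\<close> need not.
\<close>

lemma seqprod_scaleC:
  "seqprod (\<lambda>j. c j *\<^sub>C x j) l = (\<Prod>j=1..l. c j) *\<^sub>C seqprod x l" for x :: "nat \<Rightarrow> 'b::cbanach_algebra"
proof (induction l)
  case 0
  show ?case using bounded_bilinear.zero_right[OF bounded_bilinear_scaleC] by simp
next
  case (Suc l)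
  then show ?case
    by (simp add: mult_scaleC_left mult_scaleC_right scaleC_scaleC mult.commute)
qed

lemma norm_seqprod_le:
  obtains K where "K \<ge> 0"
    "\<And>a :: nat \<Rightarrow> 'b::cbanach_algebra. norm (seqprod a l) \<le> K * (\<Prod>j=1..l. norm (a j))"
proof -
  obtain K where K: "K > 0" "\<And>x y::'b. norm (x * y) \<le> norm x * norm y * K"
    using bounded_bilinear.pos_bounded[OF bounded_bilinear_times] by metis
  have "\<exists>L\<ge>0. \<forall>a :: nat \<Rightarrow> 'b. norm (seqprod a l) \<le> L * (\<Prod>j=1..l. norm (a j))"
  proof (induction l)
    case 0
    show ?case by (rule exI[of _ 0]) simp
  next
    case (Suc l)
    show ?case
    proof (cases "l = 0")
      case True
      then show ?thesis by (intro exI[of _ 1]) simp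
    next
      case False
      obtain L where L: "L \<ge> 0" "\<And>a :: nat \<Rightarrow> 'b. norm (seqprod a l) \<le> L * (\<Prod>j=1..l. norm (a j))"
        using Suc by metis
      have "norm (seqprod a (Suc l)) \<le> L * K * (\<Prod>j=1..Suc l. norm (a j))" for a :: "nat \<Rightarrow> 'b"
      proof -
        have "norm (seqprod a (Suc l)) \<le> norm (seqprod a l) * norm (a (Suc l)) * K"
          using False K(2) by simp
        also have "\<dots> \<le> L * (\<Prod>j=1..l. norm (a j)) * norm (a (Suc l)) * K"
          using K(1) by (intro mult_right_mono L(2)) auto
        finally show ?thesis by (simp add: mult_ac)
      qed
      then show ?thesis using L(1) K(1) by (intro exI[of _ "L * K"]) auto
    qed
  qed
  then show ?thesis using that by metis
qed

text \<open>
  Cauchy products of absolutely summable families; completeness of the target turns the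
  summability of the norms into summability over the product set.
\<close>

lemma bounded_bilinear_has_sum_product:
  fixes prod :: "'a::real_normed_vector \<Rightarrow> 'b::real_normed_vector \<Rightarrow> 'c::banach"
    and f :: "'i \<Rightarrow> 'a" and g :: "'j \<Rightarrow> 'b"
  assumes "bounded_bilinear prod" and "(f has_sum s) A" "(g has_sum t) B"
    and nf: "(\<lambda>x. norm (f x)) summable_on A" and ng: "(\<lambda>y. norm (g y)) summable_on B"
  shows "((\<lambda>(x, y). prod (f x) (g y)) has_sum prod s t) (A \<times> B)"
    and "(\<lambda>(x, y). norm (prod (f x) (g y))) summable_on A \<times> B"
proof -
  interpret bounded_bilinear prod by fact
  obtain K where K: "K > 0" "\<And>x y. norm (prod x y) \<le> norm x * norm y * K"
    using pos_bounded by metis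
  have "(\<lambda>(x, y). norm (f x) * norm (g y)) summable_on A \<times> B"
  proof (rule summable_on_SigmaI)
    show "((\<lambda>y. (\<lambda>(x, y). norm (f x) * norm (g y)) (x, y)) has_sum norm (f x) * infsum (\<lambda>y. norm (g y)) B) B" for x
      using has_sum_cmult_right[OF has_sum_infsum[OF ng]] by simp
    show "(\<lambda>x. norm (f x) * infsum (\<lambda>y. norm (g y)) B) summable_on A"
      using nf by (rule summable_on_cmult_left)
  qed auto
  then have "(\<lambda>z. (\<lambda>(x, y). norm (f x) * norm (g y)) z * K) summable_on A \<times> B"
    by (rule summable_on_cmult_left)
  then have n: "(\<lambda>z. norm ((\<lambda>(x, y). prod (f x) (g y)) z)) summable_on A \<times> B"
    by (rule Infinite_Sum.abs_summable_on_comparison_test') (use K in auto)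
  then show "(\<lambda>(x, y). norm (prod (f x) (g y))) summable_on A \<times> B"
    by (simp add: case_prod_unfold)
  show "((\<lambda>(x, y). prod (f x) (g y)) has_sum prod s t) (A \<times> B)"
  proof (rule has_sum_SigmaI)
    show "((\<lambda>y. (\<lambda>(x, y). prod (f x) (g y)) (x, y)) has_sum prod (f x) t) B" for x
      using has_sum_bounded_linear[OF bounded_linear_right assms(3)] by simp
    show "((\<lambda>x. prod (f x) t) has_sum prod s t) A"
      by (rule has_sum_bounded_linear[OF bounded_linear_left assms(2)])
    show "(\<lambda>(x, y). prod (f x) (g y)) summable_on A \<times> B" by (rule abs_summable_summable[OF n])
  qed
qed

text \<open>
  Expanding a product of \<open>l\<close> series, by induction on the number of factors: the last coordinate of
  a tuple is split off, and the Cauchy product of two families applies.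
\<close>

lemma seqprod_has_sum:
  fixes a :: "nat \<Rightarrow> 'i \<Rightarrow> 'b::cbanach_algebra"
  assumes "1 \<le> l"
    and "\<And>j. j \<in> {1..l} \<Longrightarrow> (a j has_sum s j) (A j)"
    and "\<And>j. j \<in> {1..l} \<Longrightarrow> (\<lambda>x. norm (a j x)) summable_on A j"
  shows "((\<lambda>k. seqprod (\<lambda>j. a j (k j)) l) has_sum seqprod s l) (\<Pi>\<^sub>E j\<in>{1..l}. A j)"
    and "(\<lambda>k. norm (seqprod (\<lambda>j. a j (k j)) l)) summable_on (\<Pi>\<^sub>E j\<in>{1..l}. A j)"
proof -
  have "((\<lambda>k. seqprod (\<lambda>j. a j (k j)) l) has_sum seqprod s l) (\<Pi>\<^sub>E j\<in>{1..l}. A j) \<and>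
      (\<lambda>k. norm (seqprod (\<lambda>j. a j (k j)) l)) summable_on (\<Pi>\<^sub>E j\<in>{1..l}. A j)"
    using assms
  proof (induction l rule: nat_induct_at_least)
    case base
    let ?i = "\<lambda>x j. if j = Suc 0 then x else undefined" and ?j = "\<lambda>k. k (Suc 0)"
    have "((\<lambda>k. seqprod (\<lambda>j. a j (k j)) 1) has_sum seqprod s 1) (\<Pi>\<^sub>E j\<in>{1..1}. A j)
        \<longleftrightarrow> (a 1 has_sum s 1) (A 1)"
      by (rule has_sum_reindex_bij_witness[where i = ?i and j = ?j])
        (auto simp: PiE_iff extensional_def)
    moreover have "(\<lambda>k. norm (seqprod (\<lambda>j. a j (k j)) 1)) summable_on (\<Pi>\<^sub>E j\<in>{1..1}. A j)
        \<longleftrightarrow> (\<lambda>x. norm (a 1 x)) summable_on (A 1)"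
      by (rule summable_on_reindex_bij_witness[where i = ?i and j = ?j])
        (auto simp: PiE_iff extensional_def)
    ultimately show ?case using base by simp
  next
    case (Suc l)
    let ?P = "\<Pi>\<^sub>E j\<in>{1..l}. A j"
    let ?f = "\<lambda>k. seqprod (\<lambda>j. a j (k j)) l"
    have IH: "(?f has_sum seqprod s l) ?P" "(\<lambda>k. norm (?f k)) summable_on ?P"
      using Suc.IH Suc.prems by auto
    have new: "(a (Suc l) has_sum s (Suc l)) (A (Suc l))" "(\<lambda>x. norm (a (Suc l) x)) summable_on A (Suc l)"
      using Suc.prems by auto
    note prod = bounded_bilinear_has_sum_product[OF bounded_bilinear_times IH(1) new(1) IH(2) new(2)]
    let ?i = "\<lambda>(k, x). k(Suc l := x)" and ?j = "\<lambda>k. (k(Suc l := undefined), k (Suc l))"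
    have ins: "{1..Suc l} = insert (Suc l) {1..l}" "Suc l \<notin> {1..l}" by auto
    have bij: "bij_betw ?i (?P \<times> A (Suc l)) (\<Pi>\<^sub>E j\<in>{1..Suc l}. A j)"
    proof (rule bij_betwI[where g = ?j])
      show "?i \<in> ?P \<times> A (Suc l) \<rightarrow> (\<Pi>\<^sub>E j\<in>{1..Suc l}. A j)"
        unfolding ins(1) by (intro funcsetI) (clarsimp simp only: mem_Sigma_iff prod.case, rule PiE_fun_upd)
      show "?j \<in> (\<Pi>\<^sub>E j\<in>{1..Suc l}. A j) \<rightarrow> ?P \<times> A (Suc l)"
        unfolding ins(1)
      proof (intro funcsetI SigmaI)
        fix k assume k: "k \<in> Pi\<^sub>E (insert (Suc l) {1..l}) A"
        show "k(Suc l := undefined) \<in> ?P" by (rule fun_upd_in_PiE[OF ins(2) k])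
        show "k (Suc l) \<in> A (Suc l)" using k by (rule PiE_mem) simp
      qed
      show "?j (?i z) = z" if "z \<in> ?P \<times> A (Suc l)" for z
      proof -
        have "fst z \<in> ?P" using that by auto
        then have "fst z (Suc l) = undefined" using ins(2) by (rule PiE_arb)
        then have "(fst z)(Suc l := undefined) = fst z" by (metis fun_upd_triv)
        then show ?thesis by (simp add: case_prod_unfold)
      qed
    qed simp
    have step: "seqprod (\<lambda>j. a j (?i z j)) (Suc l) = (case z of (k, x) \<Rightarrow> ?f k * a (Suc l) x)" for z
    proof (cases z)
      case (Pair k x)
      have "seqprod (\<lambda>j. a j ((k(Suc l := x)) j)) l = ?f k"
        by (rule seqprod_cong) simp
      then show ?thesis using Suc.hyps Pair by simp
    qed
    have "((\<lambda>k. seqprod (\<lambda>j. a j (k j)) (Suc l)) has_sum seqprod s l * s (Suc l)) (\<Pi>\<^sub>E j\<in>{1..Suc l}. A j)"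
      using prod(1) unfolding has_sum_reindex_bij_betw[OF bij, symmetric] step .
    then have "((\<lambda>k. seqprod (\<lambda>j. a j (k j)) (Suc l)) has_sum seqprod s (Suc l)) (\<Pi>\<^sub>E j\<in>{1..Suc l}. A j)"
      using Suc.hyps by simp
    moreover have "(\<lambda>k. norm (seqprod (\<lambda>j. a j (k j)) (Suc l))) summable_on (\<Pi>\<^sub>E j\<in>{1..Suc l}. A j)"
      using prod(2) unfolding summable_on_reindex_bij_betw[OF bij, symmetric] step
      by (simp add: case_prod_unfold)
    ultimately show ?case by blast
  qed
  then show "((\<lambda>k. seqprod (\<lambda>j. a j (k j)) l) has_sum seqprod s l) (\<Pi>\<^sub>E j\<in>{1..l}. A j)"
    and "(\<lambda>k. norm (seqprod (\<lambda>j. a j (k j)) l)) summable_on (\<Pi>\<^sub>E j\<in>{1..l}. A j)" by auto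
qed

lemma has_sum_finite_sum:
  fixes f :: "'n \<Rightarrow> 'i \<Rightarrow> 'b::topological_comm_monoid_add"
  assumes "finite I" "\<And>n. n \<in> I \<Longrightarrow> (f n has_sum s n) A"
  shows "((\<lambda>k. \<Sum>n\<in>I. f n k) has_sum (\<Sum>n\<in>I. s n)) A"
  using assms by (induction I rule: finite_induct) (auto intro: has_sum_add)

section \<open>Frequency vectors\<close>

lemma Zstar_term_le: "\<bar>real_of_int (k i)\<bar> \<le> angle i ^ \<eta> * \<bar>real_of_int (k i)\<bar>"
  by (simp add: mult_le_cancel_right1 angle_def one_le_power)

text \<open>
  The terms of a convergent series tend to \<open>0\<close>, and a nonzero integer has modulus at least \<open>1\<close>.
\<close>

lemma Zstar_finite_support: "finite {i. k i \<noteq> 0}" if "k \<in> Zstar \<eta>"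
proof -
  have "(\<lambda>i. angle i ^ \<eta> * \<bar>real_of_int (k i)\<bar>) \<longlonglongrightarrow> 0"
    using that by (auto simp: Zstar_def intro: summable_LIMSEQ_zero)
  then have "\<forall>\<^sub>F i in sequentially. angle i ^ \<eta> * \<bar>real_of_int (k i)\<bar> < 1"
    by (rule order_tendstoD) simp
  then obtain n where n: "\<And>i. i \<ge> n \<Longrightarrow> angle i ^ \<eta> * \<bar>real_of_int (k i)\<bar> < 1"
    unfolding eventually_sequentially by blast
  have "k i = 0" if "i \<ge> n" for i
    using n[OF that] Zstar_term_le[of k i \<eta>] by linarith
  then have "{i. k i \<noteq> 0} \<subseteq> {..<n}" by (auto simp: not_le[symmetric])
  then show ?thesis by (rule finite_subset) simp
qed

lemma kdot_eq_sum:
  assumes "k \<in> Zstar \<eta>"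
  shows "kdot k \<theta> = (\<Sum>i | k i \<noteq> 0. real_of_int (k i) * \<theta> i)"
  unfolding kdot_def by (rule suminf_finite) (use Zstar_finite_support[OF assms] in auto)

lemma kdot_zero: "kdot (\<lambda>_. 0) \<theta> = 0"
  by (simp add: kdot_def)

text \<open>
  Reducing coordinates modulo \<open>1\<close> changes \<open>k \<cdot> \<theta>\<close> by an integer, because \<open>k\<close> has finite support.
\<close>

lemma cis_kdot_rotation:
  assumes "k \<in> Zstar \<eta>"
  shows "cis (2 * pi * kdot k (rotation \<rho> s \<theta>)) = cis (2 * pi * (kdot k \<theta> + s * kdot k \<rho>))"
proof -
  have "real_of_int (k i) * rotation \<rho> s \<theta> i
      = real_of_int (k i) * \<theta> i + s * (real_of_int (k i) * \<rho> i) - of_int (k i * \<lfloor>\<theta> i + s * \<rho> i\<rfloor>)" for i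
    by (simp add: rotation_def frac_def algebra_simps)
  then have 1: "kdot k (rotation \<rho> s \<theta>)
      = kdot k \<theta> + s * kdot k \<rho> - of_int (\<Sum>i | k i \<noteq> 0. k i * \<lfloor>\<theta> i + s * \<rho> i\<rfloor>)"
    unfolding kdot_eq_sum[OF assms]
    by (simp only: sum.distrib sum_subtractf sum_distrib_left of_int_sum)
  have 2: "cis (2 * pi * (x - of_int n)) = cis (2 * pi * x)" for x n
    by (simp add: right_diff_distrib cis_divide[symmetric] cis_multiple_2pi)
  show ?thesis unfolding 1 2 ..
qed

lemma zero_in_Zstar: "(\<lambda>_. 0) \<in> Zstar \<eta>"
  by (simp add: Zstar_def)

lemma knorm_zero: "knorm \<eta> (\<lambda>_. 0) = 0"
  by (simp add: knorm_def)

lemma knorm_nonneg: "k \<in> Zstar \<eta> \<Longrightarrow> 0 \<le> knorm \<eta> k"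
  unfolding knorm_def Zstar_def by (intro suminf_nonneg) (auto simp: angle_def)

lemma knorm_ge_1:
  assumes "k \<in> Zstar \<eta>" "k \<noteq> (\<lambda>_. 0)"
  shows "1 \<le> knorm \<eta> k"
proof -
  obtain i where "k i \<noteq> 0" using assms(2) by auto
  then have "1 \<le> \<bar>real_of_int (k i)\<bar>" by linarith
  also have "\<dots> \<le> angle i ^ \<eta> * \<bar>real_of_int (k i)\<bar>" by (rule Zstar_term_le)
  also have "\<dots> = (\<Sum>i\<in>{i}. angle i ^ \<eta> * \<bar>real_of_int (k i)\<bar>)" by simp
  also have "\<dots> \<le> knorm \<eta> k"
    unfolding knorm_def by (rule sum_le_suminf) (use assms(1) in \<open>auto simp: Zstar_def angle_def\<close>)
  finally show ?thesis .
qed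

text \<open>
  A nonzero frequency of the least possible norm \<open>1\<close>; it serves to fill vanishing components of a
  joint frequency.
\<close>

definition unit_freq :: "nat \<Rightarrow> int" where
  "unit_freq i = (if i = 0 then 1 else 0)"

lemma unit_freq: "unit_freq \<in> Zstar \<eta> - {\<lambda>_. 0}" "knorm \<eta> unit_freq = 1"
proof -
  have "(\<lambda>i. angle i ^ \<eta> * \<bar>real_of_int (unit_freq i)\<bar>) sums (\<Sum>i\<in>{0}. angle i ^ \<eta> * \<bar>real_of_int (unit_freq i)\<bar>)"
    by (rule sums_finite) (auto simp: unit_freq_def)
  then have s: "(\<lambda>i. angle i ^ \<eta> * \<bar>real_of_int (unit_freq i)\<bar>) sums 1"
    by (simp add: unit_freq_def angle_def)
  then show "unit_freq \<in> Zstar \<eta> - {\<lambda>_. 0}"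
    by (auto simp: Zstar_def sums_iff fun_eq_iff unit_freq_def)
  show "knorm \<eta> unit_freq = 1" using s by (simp add: knorm_def sums_iff)
qed

lemma approximation_functionD:
  assumes "approximation_function f"
  shows "1 \<le> x \<Longrightarrow> 1 \<le> f x" and "1 \<le> x \<Longrightarrow> x \<le> y \<Longrightarrow> f x \<le> f y"
proof -
  show "1 \<le> f x" if "1 \<le> x"
    using assms that by (auto simp: approximation_function_def image_subset_iff)
  show "f x \<le> f y" if "1 \<le> x" "x \<le> y"
    using assms that by (intro strict_mono_on_leD[of "{1..}" f]) (auto simp: approximation_function_def)
qed

section \<open>Summability over joint frequencies\<close>

definition zero_joint :: "nat \<Rightarrow> nat \<Rightarrow> nat \<Rightarrow> int" where
  "zero_joint l = (\<lambda>j\<in>{1..l}. \<lambda>_. 0)"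

lemma zero_joint_in: "zero_joint l \<in> joint_vectors \<eta> l"
  by (auto simp: zero_joint_def joint_vectors_def zero_in_Zstar)

lemma joint_vectors_nonzero:
  assumes "k \<in> joint_vectors \<eta> l - {zero_joint l}"
  shows "\<exists>j\<in>{1..l}. k j \<noteq> (\<lambda>_. 0)" and "1 \<le> joint_norm \<eta> l k"
proof -
  have k: "k \<in> (\<Pi>\<^sub>E j\<in>{1..l}. Zstar \<eta>)" using assms by (simp add: joint_vectors_def)
  show ex: "\<exists>j\<in>{1..l}. k j \<noteq> (\<lambda>_. 0)"
  proof (rule ccontr)
    assume "\<not> ?thesis"
    then have "k = zero_joint l"
      using PiE_arb[OF k] by (intro ext) (auto simp: zero_joint_def)
    then show False using assms by simp
  qed
  then obtain i where i: "i \<in> {1..l}" "k i \<noteq> (\<lambda>_. 0)" by blast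
  have "1 \<le> knorm \<eta> (k i)" using i k by (intro knorm_ge_1) (auto simp: PiE_iff)
  also have "\<dots> \<le> joint_norm \<eta> l k"
    unfolding joint_norm_def using i k
    by (intro member_le_sum) (auto simp: PiE_iff intro!: knorm_nonneg)
  finally show "1 \<le> joint_norm \<eta> l k" .
qed

text \<open>
  The bound for the Fourier coefficient at \<open>k\<close>, up to a constant.  The regularity class does not
  control the mean, whence the value \<open>1\<close> at \<open>k = 0\<close>.
\<close>

definition decay :: "nat \<Rightarrow> (real \<Rightarrow> real) \<Rightarrow> (nat \<Rightarrow> int) \<Rightarrow> real" where
  "decay \<eta> \<Delta> k = (if k = (\<lambda>_. 0) then 1 else 1 / \<Delta> (knorm \<eta> k))"

lemma decay_nonneg: "0 \<le> decay \<eta> \<Delta> k" if "approximation_function \<Delta>" "k \<in> Zstar \<eta>"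
  using approximation_functionD(1)[OF that(1) knorm_ge_1[OF that(2)]]
  by (auto simp: decay_def)

text \<open>
  The hypothesis only concerns joint frequencies all of whose components are nonzero, whereas the
  expansion of the product also contains those with some vanishing components.  They are grouped
  according to the set \<open>S\<close> of nonvanishing components.  Filling the other components by a fixed
  vector of norm \<open>1\<close> embeds each group into the index set of the hypothesis; the filling
  does not decrease \<open>\<Theta>\<close>, by monotonicity, and lowers the product of the decay bounds at most by
  the constant factor \<open>\<Prod>\<^sub>j \<Delta>\<^sub>j(1)\<close>.
\<close>

lemma summable_on_joint_vectors:
  fixes \<Theta> :: "real \<Rightarrow> real" and \<Delta> :: "nat \<Rightarrow> real \<Rightarrow> real"
  assumes \<Theta>: "approximation_function \<Theta>"
    and \<Delta>: "\<And>j. j \<in> {1..l} \<Longrightarrow> approximation_function (\<Delta> j)"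
    and sum: "(\<lambda>k. \<Theta> (\<Sum>j=1..l. knorm \<eta> (k j)) ^ m / (\<Prod>j=1..l. \<Delta> j (knorm \<eta> (k j))))
           summable_on (\<Pi>\<^sub>E j\<in>{1..l}. Zstar \<eta> - {\<lambda>_. 0})"
  shows "(\<lambda>k. \<Theta> (joint_norm \<eta> l k) ^ m * (\<Prod>j=1..l. decay \<eta> (\<Delta> j) (k j)))
           summable_on (joint_vectors \<eta> l - {zero_joint l})"
proof -
  define g where "g k = \<Theta> (\<Sum>j=1..l. knorm \<eta> (k j)) ^ m / (\<Prod>j=1..l. \<Delta> j (knorm \<eta> (k j)))" for k
  define f where "f k = \<Theta> (joint_norm \<eta> l k) ^ m * (\<Prod>j=1..l. decay \<eta> (\<Delta> j) (k j))" for k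
  define R where "R = (\<Prod>j=1..l. \<Delta> j 1)"
  define V where "V S = {k \<in> joint_vectors \<eta> l. k \<noteq> zero_joint l \<and> {j\<in>{1..l}. k j \<noteq> (\<lambda>_. 0)} = S}" for S
  define fill where "fill S k = (\<lambda>j\<in>{1..l}. if j \<in> S then k j else unit_freq)" for S and k :: "nat \<Rightarrow> nat \<Rightarrow> int"
  have VD: "k \<in> joint_vectors \<eta> l - {zero_joint l}" "j \<in> {1..l} \<Longrightarrow> k j \<noteq> (\<lambda>_. 0) \<longleftrightarrow> j \<in> S"
    if "k \<in> V S" for k j S
    using that unfolding V_def by blast+
  have kZ: "k j \<in> Zstar \<eta>" if "k \<in> V S" "j \<in> {1..l}" for k j S
    using VD(1)[OF that(1)] that(2) unfolding joint_vectors_def by (blast dest: PiE_mem)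
  have fill_in: "fill S k j = k j" if "j \<in> {1..l}" "j \<in> S" for k j S
    using that unfolding fill_def by (simp only: restrict_apply if_True)
  have fill_out: "fill S k j = unit_freq" if "j \<in> {1..l}" "j \<notin> S" for k j S
    using that unfolding fill_def by (simp only: restrict_apply if_True if_False)
  have "f summable_on V S" for S
  proof -
    have inj: "inj_on (fill S) (V S)"
    proof (rule inj_onI, rule ext)
      fix k k' j assume k: "k \<in> V S" "k' \<in> V S" and eq: "fill S k = fill S k'"
      consider "j \<notin> {1..l}" | "j \<in> {1..l}" "j \<in> S" | "j \<in> {1..l}" "j \<notin> S" by blast
      then show "k j = k' j"
      proof cases
        case 1
        have "k \<in> (\<Pi>\<^sub>E j\<in>{1..l}. Zstar \<eta>)" "k' \<in> (\<Pi>\<^sub>E j\<in>{1..l}. Zstar \<eta>)"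
          using VD(1) k unfolding joint_vectors_def by blast+
        then show ?thesis using 1 PiE_arb by metis
      next
        case 2
        then show ?thesis using fill_in eq by metis
      next
        case 3
        then show ?thesis using VD(2) k by metis
      qed
    qed
    have sub: "fill S ` V S \<subseteq> (\<Pi>\<^sub>E j\<in>{1..l}. Zstar \<eta> - {\<lambda>_. 0})"
    proof (rule image_subsetI, rule PiE_I)
      fix k j assume k: "k \<in> V S" and j: "j \<in> {1..l}"
      show "fill S k j \<in> Zstar \<eta> - {\<lambda>_. 0}"
        using VD(2)[OF k j] kZ[OF k j] fill_in[OF j] fill_out[OF j] unit_freq(1)
        by (cases "j \<in> S") auto
    qed (auto simp: fill_def restrict_def)
    have "g summable_on fill S ` V S"
      using sum sub unfolding g_def by (rule summable_on_subset_banach)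
    then have "(\<lambda>k. g (fill S k)) summable_on V S"
      using summable_on_reindex[OF inj, of g] by (simp add: o_def)
    then have "(\<lambda>k. R * g (fill S k)) summable_on V S"
      by (rule summable_on_cmult_right)
    then show ?thesis
    proof (rule summable_on_comparison_test)
      fix k assume k: "k \<in> V S"
      note kZ = kZ[OF k]
      have jn: "1 \<le> joint_norm \<eta> l k"
        by (rule joint_vectors_nonzero(2)[OF VD(1)[OF k]])
      have le: "knorm \<eta> (k j) \<le> knorm \<eta> (fill S k j)" if "j \<in> {1..l}" for j
        using VD(2)[OF k that] fill_in[OF that] fill_out[OF that] unit_freq(2)
        by (cases "j \<in> S") (auto simp: knorm_zero)
      have "joint_norm \<eta> l k \<le> (\<Sum>j=1..l. knorm \<eta> (fill S k j))"
        unfolding joint_norm_def by (intro sum_mono le)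
      then have 1: "\<Theta> (joint_norm \<eta> l k) ^ m \<le> \<Theta> (\<Sum>j=1..l. knorm \<eta> (fill S k j)) ^ m"
        using jn approximation_functionD[OF \<Theta>] by (intro power_mono) (auto intro: order_trans[of 0 1])
      have "decay \<eta> (\<Delta> j) (k j) \<le> \<Delta> j 1 / \<Delta> j (knorm \<eta> (fill S k j))" if j: "j \<in> {1..l}" for j
      proof -
        have d1: "1 \<le> \<Delta> j 1" using approximation_functionD(1)[OF \<Delta>[OF j]] by simp
        show ?thesis
        proof (cases "j \<in> S")
          case True
          then have "k j \<noteq> (\<lambda>_. 0)" using VD(2)[OF k j] by blast
          then have "1 \<le> \<Delta> j (knorm \<eta> (k j))"
            using approximation_functionD(1)[OF \<Delta>[OF j]] knorm_ge_1 kZ[OF j] by blast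
          then show ?thesis using \<open>k j \<noteq> _\<close> d1 fill_in[OF j True] by (simp add: decay_def divide_right_mono)
        next
          case False
          then have "k j = (\<lambda>_. 0)" using VD(2)[OF k j] by blast
          then show ?thesis using fill_out[OF j False] d1 unit_freq(2) by (simp add: decay_def)
        qed
      qed
      then have "(\<Prod>j=1..l. decay \<eta> (\<Delta> j) (k j)) \<le> (\<Prod>j=1..l. \<Delta> j 1 / \<Delta> j (knorm \<eta> (fill S k j)))"
        by (intro prod_mono conjI decay_nonneg \<Delta> kZ)
      also have "\<dots> = R / (\<Prod>j=1..l. \<Delta> j (knorm \<eta> (fill S k j)))"
        by (simp add: prod_dividef R_def)
      finally have 2: "(\<Prod>j=1..l. decay \<eta> (\<Delta> j) (k j)) \<le> R / (\<Prod>j=1..l. \<Delta> j (knorm \<eta> (fill S k j)))" .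
      have pos: "0 \<le> \<Theta> (joint_norm \<eta> l k) ^ m" "0 \<le> (\<Prod>j=1..l. decay \<eta> (\<Delta> j) (k j))"
        using approximation_functionD(1)[OF \<Theta> jn]
        by (auto intro!: decay_nonneg \<Delta> kZ prod_nonneg)
      show "0 \<le> f k" unfolding f_def using pos by (rule mult_nonneg_nonneg)
      have "f k \<le> \<Theta> (\<Sum>j=1..l. knorm \<eta> (fill S k j)) ^ m * (R / (\<Prod>j=1..l. \<Delta> j (knorm \<eta> (fill S k j))))"
        unfolding f_def using 1 2 pos by (intro mult_mono) auto
      then show "f k \<le> R * g (fill S k)" by (simp add: g_def mult.commute)
    qed
  qed
  then have "f summable_on (\<Union>S\<in>Pow {1..l}. V S)"
  proof (rule summable_on_finite_union_disjoint[rotated])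
    show "V S \<inter> V S' = {}" if "S \<noteq> S'" for S S'
      using that unfolding V_def by (intro equals0I) (elim IntE CollectE conjE, metis)
  qed simp
  also have "(\<Union>S\<in>Pow {1..l}. V S) = joint_vectors \<eta> l - {zero_joint l}"
  proof (intro equalityI subsetI)
    fix k assume "k \<in> joint_vectors \<eta> l - {zero_joint l}"
    then have "k \<in> V {j\<in>{1..l}. k j \<noteq> (\<lambda>_. 0)}" unfolding V_def by simp
    then show "k \<in> (\<Union>S\<in>Pow {1..l}. V S)" by (rule UN_I[rotated]) blast
  next
    fix k assume "k \<in> (\<Union>S\<in>Pow {1..l}. V S)"
    then show "k \<in> joint_vectors \<eta> l - {zero_joint l}" using VD(1) by (elim UN_E)
  qed
  finally show ?thesis by (simp only: f_def[abs_def])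
qed

section \<open>Averages of almost periodic functions\<close>

lemma prod_cis: "(\<Prod>j\<in>A. cis (f j)) = cis (\<Sum>j\<in>A. f j)"
  by (induction A rule: infinite_finite_induct) (simp_all add: cis_mult)

lemma scaleR_cis_scaleC:
  "(r *\<^sub>R cis (2 * pi * (b + s * x))) *\<^sub>C y = (r *\<^sub>R cis (2 * pi * (s * x))) *\<^sub>C cis (2 * pi * b) *\<^sub>C y"
  by (simp add: scaleC_scaleC cis_mult algebra_simps)

lemma scaleR_scaleC: "r *\<^sub>R (c *\<^sub>C y) = (r *\<^sub>R c) *\<^sub>C (y :: 'b::cbanach_algebra)"
  by (rule bounded_bilinear.scaleR_left[OF bounded_bilinear_scaleC, symmetric])

text \<open>
  A finite average may be taken term by term; each mode \<open>k\<close> is multiplied by the kernel at its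
  frequency \<open>\<alpha> k\<close>.
\<close>

lemma discrete_average_has_sum:
  fixes a :: "'i \<Rightarrow> 'b::cbanach_algebra" and G :: "real \<Rightarrow> 'b"
  assumes G: "\<And>s. ((\<lambda>k. cis (2 * pi * (\<beta> k + s * \<alpha> k)) *\<^sub>C a k) has_sum G s) J"
  shows "((\<lambda>k. discrete_kernel N (\<alpha> k) *\<^sub>C cis (2 * pi * \<beta> k) *\<^sub>C a k) has_sum
     inverse (\<Sum>s<N. weight (real s / real N)) *\<^sub>R (\<Sum>n<N. weight (real n / real N) *\<^sub>R G (real n))) J"
proof -
  have "((\<lambda>k. inverse (\<Sum>s<N. weight (real s / real N)) *\<^sub>R
      (\<Sum>n<N. weight (real n / real N) *\<^sub>R (cis (2 * pi * (\<beta> k + real n * \<alpha> k)) *\<^sub>C a k))) has_sum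
      inverse (\<Sum>s<N. weight (real s / real N)) *\<^sub>R (\<Sum>n<N. weight (real n / real N) *\<^sub>R G (real n))) J"
    by (intro has_sum_scaleR has_sum_finite_sum G finite_lessThan)
  also have "(\<lambda>k. inverse (\<Sum>s<N. weight (real s / real N)) *\<^sub>R
      (\<Sum>n<N. weight (real n / real N) *\<^sub>R (cis (2 * pi * (\<beta> k + real n * \<alpha> k)) *\<^sub>C a k)))
      = (\<lambda>k. discrete_kernel N (\<alpha> k) *\<^sub>C cis (2 * pi * \<beta> k) *\<^sub>C a k)"
    by (simp only: scaleR_scaleC scaleR_cis_scaleC discrete_kernel_def
        bounded_bilinear.sum_left[OF bounded_bilinear_scaleC, symmetric])
  finally show ?thesis .
qed

text \<open>
  The series of the moduli does not depend on \<open>s\<close>, so the convergence is uniform in \<open>s\<close> and the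
  integral may be taken term by term.
\<close>

lemma continuous_average_has_sum:
  fixes a :: "'i \<Rightarrow> 'b::cbanach_algebra" and G :: "real \<Rightarrow> 'b"
  assumes G: "\<And>s. ((\<lambda>k. cis (2 * pi * (\<beta> k + s * \<alpha> k)) *\<^sub>C a k) has_sum G s) J"
    and na: "(\<lambda>k. norm (a k)) summable_on J"
  shows "((\<lambda>k. continuous_kernel T (\<alpha> k) *\<^sub>C cis (2 * pi * \<beta> k) *\<^sub>C a k) has_sum
     inverse T *\<^sub>R integral {0..T} (\<lambda>s. weight (s / T) *\<^sub>R G s)) J"
proof -
  define f where "f k s = weight (s / T) *\<^sub>R (cis (2 * pi * (\<beta> k + s * \<alpha> k)) *\<^sub>C a k)" for k s
  obtain D where D: "D 0 = weight" "\<And>i::nat. \<exists>B. \<forall>x. \<bar>D i x\<bar> \<le> B"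
    using weight_derivatives by metis
  obtain B where B: "\<And>x. \<bar>weight x\<bar> \<le> B" using D(2)[of 0] D(1) by auto
  have cont_w: "continuous_on {0..T} (\<lambda>s. weight (s / T))"
  proof (rule continuous_on_compose2[OF continuous_on_weight[of UNIV]])
    show "continuous_on {0..T} (\<lambda>s. s / T)"
      by (cases "T = 0") (auto intro!: continuous_intros)
  qed simp
  have cont_cis: "continuous_on {0..T} (\<lambda>s. cis (2 * pi * (s * x)))" for x
    by (intro continuous_intros)
  have f_eq: "f k s = (weight (s / T) *\<^sub>R cis (2 * pi * (s * \<alpha> k))) *\<^sub>C cis (2 * pi * \<beta> k) *\<^sub>C a k" for k s
    unfolding f_def scaleR_scaleC scaleR_cis_scaleC ..
  have cont_f: "continuous_on {0..T} (f k)" for k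
    unfolding f_eq[abs_def]
    by (intro bounded_bilinear.continuous_on[OF bounded_bilinear_scaleC] continuous_on_scaleR
        cont_w cont_cis continuous_on_const)
  have int_f: "(f k has_integral (T *\<^sub>R continuous_kernel T (\<alpha> k)) *\<^sub>C cis (2 * pi * \<beta> k) *\<^sub>C a k) {0..T}" for k
  proof -
    have "((\<lambda>s. weight (s / T) *\<^sub>R cis (2 * pi * (s * \<alpha> k))) has_integral
        integral {0..T} (\<lambda>s. weight (s / T) *\<^sub>R cis (2 * pi * (s * \<alpha> k)))) {0..T}"
      by (intro integrable_integral integrable_continuous_interval continuous_on_scaleR cont_w cont_cis)
    moreover have "integral {0..T} (\<lambda>s. weight (s / T) *\<^sub>R cis (2 * pi * (s * \<alpha> k))) = T *\<^sub>R continuous_kernel T (\<alpha> k)"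
      by (cases "T = 0") (simp_all add: continuous_kernel_def)
    ultimately have "((\<lambda>s. weight (s / T) *\<^sub>R cis (2 * pi * (s * \<alpha> k))) has_integral T *\<^sub>R continuous_kernel T (\<alpha> k)) {0..T}"
      by simp
    from has_integral_linear[OF this bounded_bilinear.bounded_linear_left[OF bounded_bilinear_scaleC]]
    show ?thesis by (simp add: o_def f_eq[abs_def])
  qed
  have unif: "uniform_limit {0..T} (\<lambda>K s. \<Sum>k\<in>K. f k s) (\<lambda>s. weight (s / T) *\<^sub>R G s) (finite_subsets_at_top J)"
  proof (rule Weierstrass_m_test_general')
    show "norm (f k s) \<le> B * norm (a k)" for k s
      using B[of "s / T"] by (simp add: f_def norm_scaleC mult_right_mono)
    show "((\<lambda>k. f k s) has_sum weight (s / T) *\<^sub>R G s) J" for s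
      unfolding f_def by (intro has_sum_scaleR G)
    show "(\<lambda>k. B * norm (a k)) summable_on J"
      using na by (rule summable_on_cmult_right)
  qed
  obtain I L where I: "\<And>K. ((\<lambda>s. \<Sum>k\<in>K. f k s) has_integral I K) {0..T}"
    and L: "((\<lambda>s. weight (s / T) *\<^sub>R G s) has_integral L) {0..T}"
    and lim: "(I \<longlongrightarrow> L) (finite_subsets_at_top J)"
    by (rule uniform_limit_integral[OF unif]) (auto intro!: continuous_on_sum cont_f)
  \<comment> \<open>For infinite \<open>K\<close> the sum in \<open>I\<close> is \<open>0\<close> by convention, but the filter only contains finite sets.\<close>
  have "\<forall>\<^sub>F K in finite_subsets_at_top J. I K = (\<Sum>k\<in>K. (T *\<^sub>R continuous_kernel T (\<alpha> k)) *\<^sub>C cis (2 * pi * \<beta> k) *\<^sub>C a k)"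
    by (rule eventually_finite_subsets_at_top_weakI)
      (rule has_integral_unique[OF I has_integral_sum[OF _ int_f]])
  with lim have "((\<lambda>k. (T *\<^sub>R continuous_kernel T (\<alpha> k)) *\<^sub>C cis (2 * pi * \<beta> k) *\<^sub>C a k) has_sum L) J"
    unfolding has_sum_def by (rule Lim_transform_eventually)
  then have "((\<lambda>k. inverse T *\<^sub>R ((T *\<^sub>R continuous_kernel T (\<alpha> k)) *\<^sub>C cis (2 * pi * \<beta> k) *\<^sub>C a k)) has_sum inverse T *\<^sub>R L) J"
    by (rule has_sum_scaleR)
  moreover have "inverse T *\<^sub>R ((T *\<^sub>R continuous_kernel T x) *\<^sub>C y) = continuous_kernel T x *\<^sub>C y" for x and y :: 'b
    unfolding scaleR_scaleC by (cases "T = 0") (simp_all add: continuous_kernel_def)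
  ultimately show ?thesis using integral_unique[OF L] by simp
qed

text \<open>
  The term at \<open>z\<close> is the limit, reproduced exactly by a multiplier with \<open>W z = 1\<close>; the error is
  the sum of all other terms.
\<close>

lemma multiplier_error_bound:
  fixes a :: "'i \<Rightarrow> 'b::cbanach_algebra"
  assumes avg: "((\<lambda>k. W k *\<^sub>C u k *\<^sub>C a k) has_sum S) J"
    and z: "z \<in> J" "W z = 1" "u z = 1"
    and u: "\<And>k. cmod (u k) = 1"
    and W: "\<And>k. k \<in> J - {z} \<Longrightarrow> cmod (W k) \<le> E * r k"
    and sum: "(\<lambda>k. r k * norm (a k)) summable_on (J - {z})"
  shows "norm (S - a z) \<le> E * (\<Sum>\<^sub>\<infinity>k\<in>J - {z}. r k * norm (a k))"
proof -
  have "((\<lambda>k. W k *\<^sub>C u k *\<^sub>C a k) has_sum a z) {z}"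
    using z by (auto intro!: has_sum_finiteI simp: scaleC_one)
  then have S: "((\<lambda>k. W k *\<^sub>C u k *\<^sub>C a k) has_sum (S - a z)) (J - {z})"
    by (rule has_sum_Diff[OF avg]) (use z in auto)
  have s2: "(\<lambda>k. E * (r k * norm (a k))) summable_on (J - {z})"
    using sum by (rule summable_on_cmult_right)
  have le: "norm (W k *\<^sub>C u k *\<^sub>C a k) \<le> E * (r k * norm (a k))" if "k \<in> J - {z}" for k
    using mult_right_mono[OF W[OF that] norm_ge_zero[of "a k"]] u[of k] by (simp add: norm_scaleC mult.assoc)
  have s1: "(\<lambda>k. norm (W k *\<^sub>C u k *\<^sub>C a k)) summable_on (J - {z})"
    by (rule Infinite_Sum.abs_summable_on_comparison_test'[OF s2 le])
  have "norm (S - a z) \<le> (\<Sum>\<^sub>\<infinity>k\<in>J - {z}. norm (W k *\<^sub>C u k *\<^sub>C a k))"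
    by (rule norm_has_sum_bound[OF has_sum_infsum[OF s1] S])
  also have "\<dots> \<le> (\<Sum>\<^sub>\<infinity>k\<in>J - {z}. E * (r k * norm (a k)))"
    by (rule infsum_mono[OF s1 s2 le])
  also have "\<dots> = E * (\<Sum>\<^sub>\<infinity>k\<in>J - {z}. r k * norm (a k))"
    by (rule infsum_cmult_right')
  finally show ?thesis .
qed

section \<open>Joint Fourier series\<close>

definition joint_coeff :: "nat \<Rightarrow> (nat \<Rightarrow> (nat \<Rightarrow> real) \<Rightarrow> 'b::cbanach_algebra) \<Rightarrow> (nat \<Rightarrow> nat \<Rightarrow> int) \<Rightarrow> 'b" where
  "joint_coeff l F k = seqprod (\<lambda>j. fourier_coeff (F j) (k j)) l"

lemma joint_coeff_zero:
  "joint_coeff l F (zero_joint l) = seqprod (\<lambda>j. strong_integral torus (F j)) l"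
  unfolding joint_coeff_def
  by (rule seqprod_cong) (simp add: zero_joint_def fourier_coeff_def kdot_zero scaleC_one)

lemma rotation_in_torus: "rotation \<rho> s \<theta> \<in> space torus"
  by (simp add: torus_def rotation_def space_PiM PiE_UNIV_domain frac_lt_1)

text \<open>
  The product along an orbit is an almost periodic function of time \<open>s\<close> whose frequencies are the
  numbers \<open>k \<cdot> \<rho>\<close> for joint vectors \<open>k\<close>: the Fourier series are multiplied out, and the phases
  of the factors add up.
\<close>

lemma orbit_has_sum:
  fixes F :: "nat \<Rightarrow> (nat \<Rightarrow> real) \<Rightarrow> 'b::cbanach_algebra"
  assumes "1 \<le> l" and F: "\<And>j. j \<in> {1..l} \<Longrightarrow> F j \<in> fourier_class \<eta> (\<Delta> j)"
    and nF: "\<And>j. j \<in> {1..l} \<Longrightarrow> (\<lambda>k. norm (fourier_coeff (F j) k)) summable_on Zstar \<eta>"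
  shows "((\<lambda>k. cis (2 * pi * (joint_dot l k (\<lambda>_. \<theta>) + s * joint_dot l k \<rho>)) *\<^sub>C joint_coeff l F k)
      has_sum seqprod (\<lambda>j. F j (rotation (\<rho> j) s \<theta>)) l) (joint_vectors \<eta> l)"
    and "(\<lambda>k. norm (joint_coeff l F k)) summable_on (joint_vectors \<eta> l)"
proof -
  define a where "a j k = cis (2 * pi * kdot k (rotation (\<rho> j) s \<theta>)) *\<^sub>C fourier_coeff (F j) k" for j k
  have a: "(a j has_sum F j (rotation (\<rho> j) s \<theta>)) (Zstar \<eta>)" if "j \<in> {1..l}" for j
    using F[OF that] rotation_in_torus[of "\<rho> j" s \<theta>] unfolding fourier_class_def a_def[abs_def] by blast
  have na: "(\<lambda>k. norm (a j k)) summable_on Zstar \<eta>" if "j \<in> {1..l}" for j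
    using nF[OF that] by (simp add: a_def norm_scaleC)
  have eq: "seqprod (\<lambda>j. a j (k j)) l
      = cis (2 * pi * (joint_dot l k (\<lambda>_. \<theta>) + s * joint_dot l k \<rho>)) *\<^sub>C joint_coeff l F k"
    if "k \<in> joint_vectors \<eta> l" for k
  proof -
    have "cis (2 * pi * kdot (k j) (rotation (\<rho> j) s \<theta>))
        = cis (2 * pi * (kdot (k j) \<theta> + s * kdot (k j) (\<rho> j)))" if "j \<in> {1..l}" for j
      using \<open>k \<in> _\<close> that unfolding joint_vectors_def by (intro cis_kdot_rotation) (rule PiE_mem)
    then have "(\<Prod>j=1..l. cis (2 * pi * kdot (k j) (rotation (\<rho> j) s \<theta>)))
        = (\<Prod>j=1..l. cis (2 * pi * (kdot (k j) \<theta> + s * kdot (k j) (\<rho> j))))"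
      by (intro prod.cong refl)
    also have "\<dots> = cis (2 * pi * (joint_dot l k (\<lambda>_. \<theta>) + s * joint_dot l k \<rho>))"
      unfolding prod_cis joint_dot_def by (simp only: sum_distrib_left distrib_left sum.distrib)
    finally show ?thesis
      unfolding a_def seqprod_scaleC joint_coeff_def by simp
  qed
  note * = seqprod_has_sum[OF \<open>1 \<le> l\<close>, where A = "\<lambda>_. Zstar \<eta>", folded joint_vectors_def]
  show "((\<lambda>k. cis (2 * pi * (joint_dot l k (\<lambda>_. \<theta>) + s * joint_dot l k \<rho>)) *\<^sub>C joint_coeff l F k)
      has_sum seqprod (\<lambda>j. F j (rotation (\<rho> j) s \<theta>)) l) (joint_vectors \<eta> l)"
  proof -
    have "((\<lambda>k. seqprod (\<lambda>j. a j (k j)) l) has_sum seqprod (\<lambda>j. F j (rotation (\<rho> j) s \<theta>)) l)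
        (joint_vectors \<eta> l)"
      by (rule *(1)[OF a na])
    then show ?thesis by (rule has_sum_cong[THEN iffD1, rotated]) (rule eq)
  qed
  have "(\<lambda>k. norm (seqprod (\<lambda>j. a j (k j)) l)) summable_on (joint_vectors \<eta> l)"
    by (rule *(2)[OF a na])
  moreover have "norm (seqprod (\<lambda>j. a j (k j)) l) = norm (joint_coeff l F k)" if "k \<in> joint_vectors \<eta> l" for k
    using eq[OF that] by (simp add: norm_scaleC)
  ultimately show "(\<lambda>k. norm (joint_coeff l F k)) summable_on (joint_vectors \<eta> l)"
    using summable_on_cong by (metis (no_types, lifting))
qed

text \<open>
  The constant is enlarged so that it covers the mean as well.
\<close>

lemma fourier_coeff_decay:
  assumes "F \<in> fourier_class \<eta> \<Delta>" "approximation_function \<Delta>"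
  obtains M where "M \<ge> 0" "\<And>k. k \<in> Zstar \<eta> \<Longrightarrow> norm (fourier_coeff F k) \<le> M * decay \<eta> \<Delta> k"
proof -
  obtain C where C: "\<And>k. k \<in> Zstar \<eta> - {\<lambda>_. 0} \<Longrightarrow> \<Delta> (knorm \<eta> k) * norm (fourier_coeff F k) \<le> C"
    using assms(1) unfolding fourier_class_def bdd_above_def by blast
  define M where "M = max C (norm (fourier_coeff F (\<lambda>_. 0)))"
  have "norm (fourier_coeff F k) \<le> M * decay \<eta> \<Delta> k" if "k \<in> Zstar \<eta>" for k
  proof (cases "k = (\<lambda>_. 0)")
    case True
    then show ?thesis by (simp add: M_def decay_def)
  next
    case False
    have "1 \<le> \<Delta> (knorm \<eta> k)"
      using approximation_functionD(1)[OF assms(2)] knorm_ge_1[OF that False] by blast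
    moreover have "\<Delta> (knorm \<eta> k) * norm (fourier_coeff F k) \<le> M"
      using C[of k] that False by (simp add: M_def)
    ultimately show ?thesis using False by (simp add: decay_def pos_le_divide_eq mult.commute)
  qed
  moreover have "M \<ge> 0" using norm_ge_zero[of "fourier_coeff F (\<lambda>_. 0)"] by (simp add: M_def le_max_iff_disj)
  ultimately show ?thesis using that by blast
qed

text \<open>
  Both claims follow from the summability of the decay bounds over the nonzero joint frequencies:
  the second one by taking the product of the bounds for the factors, the first one by restriction
  to the joint frequencies with only the \<open>j\<close>-th component nonzero, where the other bounds are \<open>1\<close>
  and the factor \<open>\<Theta>^m\<close> is at least \<open>1\<close>.
\<close>

lemma summable_joint_coeff:
  fixes F :: "nat \<Rightarrow> (nat \<Rightarrow> real) \<Rightarrow> 'b::cbanach_algebra"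
  assumes \<Theta>: "approximation_function \<Theta>"
    and \<Delta>: "\<And>j. j \<in> {1..l} \<Longrightarrow> approximation_function (\<Delta> j)"
    and F: "\<And>j. j \<in> {1..l} \<Longrightarrow> F j \<in> fourier_class \<eta> (\<Delta> j)"
    and sum: "(\<lambda>k. \<Theta> (\<Sum>j=1..l. knorm \<eta> (k j)) ^ m / (\<Prod>j=1..l. \<Delta> j (knorm \<eta> (k j))))
           summable_on (\<Pi>\<^sub>E j\<in>{1..l}. Zstar \<eta> - {\<lambda>_. 0})"
  shows "\<And>j. j \<in> {1..l} \<Longrightarrow> (\<lambda>k. norm (fourier_coeff (F j) k)) summable_on Zstar \<eta>"
    and "(\<lambda>k. \<Theta> (joint_norm \<eta> l k) ^ m * norm (joint_coeff l F k)) summable_on (joint_vectors \<eta> l - {zero_joint l})"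
proof -
  have "\<forall>j. \<exists>M. j \<in> {1..l} \<longrightarrow> M \<ge> 0 \<and> (\<forall>k\<in>Zstar \<eta>. norm (fourier_coeff (F j) k) \<le> M * decay \<eta> (\<Delta> j) k)"
    using fourier_coeff_decay[OF F \<Delta>] by metis
  then obtain M where M: "\<And>j. j \<in> {1..l} \<Longrightarrow> M j \<ge> 0"
    "\<And>j k. j \<in> {1..l} \<Longrightarrow> k \<in> Zstar \<eta> \<Longrightarrow> norm (fourier_coeff (F j) k) \<le> M j * decay \<eta> (\<Delta> j) k"
    by metis
  have main: "(\<lambda>k. \<Theta> (joint_norm \<eta> l k) ^ m * (\<Prod>j=1..l. decay \<eta> (\<Delta> j) (k j)))
           summable_on (joint_vectors \<eta> l - {zero_joint l})"
    by (rule summable_on_joint_vectors[OF \<Theta> \<Delta> sum])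
  have \<Theta>1: "1 \<le> \<Theta> (joint_norm \<eta> l k)" if "k \<in> joint_vectors \<eta> l - {zero_joint l}" for k
    by (rule approximation_functionD(1)[OF \<Theta> joint_vectors_nonzero(2)[OF that]])
  obtain K where K: "K \<ge> 0" "\<And>a :: nat \<Rightarrow> 'b. norm (seqprod a l) \<le> K * (\<Prod>j=1..l. norm (a j))"
    using norm_seqprod_le by metis
  define R where "R = K * (\<Prod>j=1..l. M j)"
  have "norm (joint_coeff l F k) \<le> R * (\<Prod>j=1..l. decay \<eta> (\<Delta> j) (k j))" if k: "k \<in> joint_vectors \<eta> l" for k
  proof -
    have kZ: "k j \<in> Zstar \<eta>" if "j \<in> {1..l}" for j
      using k that unfolding joint_vectors_def by (rule PiE_mem)
    have "(\<Prod>j=1..l. norm (fourier_coeff (F j) (k j))) \<le> (\<Prod>j=1..l. M j * decay \<eta> (\<Delta> j) (k j))"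
      by (intro prod_mono conjI M kZ norm_ge_zero)
    then have "norm (joint_coeff l F k) \<le> K * (\<Prod>j=1..l. M j * decay \<eta> (\<Delta> j) (k j))"
      using K unfolding joint_coeff_def by (meson mult_left_mono order_trans)
    then show ?thesis by (simp add: R_def prod.distrib mult.assoc)
  qed
  note coeff = this
  have "(\<lambda>k. R * (\<Theta> (joint_norm \<eta> l k) ^ m * (\<Prod>j=1..l. decay \<eta> (\<Delta> j) (k j))))
           summable_on (joint_vectors \<eta> l - {zero_joint l})"
    using main by (rule summable_on_cmult_right)
  then show "(\<lambda>k. \<Theta> (joint_norm \<eta> l k) ^ m * norm (joint_coeff l F k)) summable_on (joint_vectors \<eta> l - {zero_joint l})"
  proof (rule summable_on_comparison_test)
    fix k assume k: "k \<in> joint_vectors \<eta> l - {zero_joint l}"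
    have p: "0 \<le> \<Theta> (joint_norm \<eta> l k) ^ m" using \<Theta>1[OF k] by (intro zero_le_power) linarith
    then show "0 \<le> \<Theta> (joint_norm \<eta> l k) ^ m * norm (joint_coeff l F k)" by simp
    show "\<Theta> (joint_norm \<eta> l k) ^ m * norm (joint_coeff l F k)
        \<le> R * (\<Theta> (joint_norm \<eta> l k) ^ m * (\<Prod>j=1..l. decay \<eta> (\<Delta> j) (k j)))"
      using mult_left_mono[OF coeff p] k by (simp add: mult.left_commute)
  qed
  show "(\<lambda>k. norm (fourier_coeff (F j) k)) summable_on Zstar \<eta>" if j: "j \<in> {1..l}" for j
  proof -
    define e where "e k = (\<lambda>i\<in>{1..l}. if i = j then k else (\<lambda>_. 0))" for k :: "nat \<Rightarrow> int"
    have ej: "e k j = k" for k using j by (simp add: e_def)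
    have e0: "e k i = (\<lambda>_. 0)" if "i \<in> {1..l} - {j}" for i k
      using that by (simp add: e_def)
    have inj: "inj_on e (Zstar \<eta> - {\<lambda>_. 0})" using ej by (metis inj_onI)
    have sub: "e ` (Zstar \<eta> - {\<lambda>_. 0}) \<subseteq> joint_vectors \<eta> l - {zero_joint l}"
    proof (rule image_subsetI)
      fix k assume k: "k \<in> Zstar \<eta> - {\<lambda>_. 0}"
      have "e k \<in> joint_vectors \<eta> l"
        unfolding joint_vectors_def e_def using k zero_in_Zstar by (intro restrict_PiE_iff[THEN iffD2]) auto
      moreover have "zero_joint l j = (\<lambda>_. 0)" using j by (simp add: zero_joint_def)
      then have "e k \<noteq> zero_joint l" using ej[of k] k by auto
      ultimately show "e k \<in> joint_vectors \<eta> l - {zero_joint l}" by blast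
    qed
    have prod: "(\<Prod>i=1..l. decay \<eta> (\<Delta> i) (e k i)) = decay \<eta> (\<Delta> j) k" for k
    proof -
      have "(\<Prod>i=1..l. decay \<eta> (\<Delta> i) (e k i)) = decay \<eta> (\<Delta> j) (e k j) * (\<Prod>i\<in>{1..l} - {j}. decay \<eta> (\<Delta> i) (e k i))"
        using j by (intro prod.remove) auto
      also have "(\<Prod>i\<in>{1..l} - {j}. decay \<eta> (\<Delta> i) (e k i)) = 1"
        by (rule prod.neutral) (use e0 in \<open>simp add: decay_def\<close>)
      finally show ?thesis by (simp add: ej)
    qed
    have "(\<lambda>k. \<Theta> (joint_norm \<eta> l k) ^ m * (\<Prod>i=1..l. decay \<eta> (\<Delta> i) (k i))) summable_on e ` (Zstar \<eta> - {\<lambda>_. 0})"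
      by (rule summable_on_subset_banach[OF main sub])
    then have "(\<lambda>k. \<Theta> (joint_norm \<eta> l (e k)) ^ m * decay \<eta> (\<Delta> j) k) summable_on (Zstar \<eta> - {\<lambda>_. 0})"
      unfolding summable_on_reindex[OF inj] o_def prod .
    then have "decay \<eta> (\<Delta> j) summable_on (Zstar \<eta> - {\<lambda>_. 0})"
    proof (rule summable_on_comparison_test)
      fix k assume k: "k \<in> Zstar \<eta> - {\<lambda>_. 0}"
      show nn: "0 \<le> decay \<eta> (\<Delta> j) k" by (rule decay_nonneg[OF \<Delta>[OF j]]) (use k in auto)
      have "e k \<in> joint_vectors \<eta> l - {zero_joint l}" using sub k by blast
      then have "1 \<le> \<Theta> (joint_norm \<eta> l (e k)) ^ m" by (rule one_le_power[OF \<Theta>1])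
      then show "decay \<eta> (\<Delta> j) k \<le> \<Theta> (joint_norm \<eta> l (e k)) ^ m * decay \<eta> (\<Delta> j) k"
        using nn by (simp add: mult_le_cancel_right1)
    qed
    then have "decay \<eta> (\<Delta> j) summable_on insert (\<lambda>_. 0) (Zstar \<eta> - {\<lambda>_. 0})"
      by (simp only: summable_on_insert_iff)
    then have "decay \<eta> (\<Delta> j) summable_on Zstar \<eta>"
      using zero_in_Zstar[of \<eta>] by (simp only: insert_Diff)
    then have "(\<lambda>k. M j * decay \<eta> (\<Delta> j) k) summable_on Zstar \<eta>"
      by (rule summable_on_cmult_right)
    then show ?thesis
      by (rule Infinite_Sum.abs_summable_on_comparison_test') (use M(2)[OF j] in auto)
  qed
qed

text \<open>
  On a nonresonant frequency, the kernel bound applies with \<open>\<delta> = \<gamma> / \<Theta>(|k|)\<close>, so that the kernel is at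
  most a constant times \<open>\<Theta>(|k|)^m\<close> times the desired rate.  This growth in \<open>k\<close> is what the
  coefficients have to compensate.
\<close>

theorem theorem3p2:
  fixes l \<eta> m :: nat
    and \<Theta> :: "real \<Rightarrow> real"
    and \<Delta> :: "nat \<Rightarrow> real \<Rightarrow> real"
    and F :: "nat \<Rightarrow> (nat \<Rightarrow> real) \<Rightarrow> 'b::cbanach_algebra"
    and \<rho> :: "nat \<Rightarrow> nat \<Rightarrow> real"
  assumes "1 \<le> l" and "2 \<le> \<eta>" and "2 \<le> m"
    and "approximation_function \<Theta>"
    and "\<forall>j\<in>{1..l}. approximation_function (\<Delta> j)"
    and "\<forall>j\<in>{1..l}. F j \<in> fourier_class \<eta> (\<Delta> j)"
    and "\<forall>j\<in>{1..l}. \<forall>i. \<rho> j i \<in> {1..2}"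
    and "(\<lambda>k. \<Theta> (\<Sum>j=1..l. knorm \<eta> (k j)) ^ m / (\<Prod>j=1..l. \<Delta> j (knorm \<eta> (k j))))
           summable_on (\<Pi>\<^sub>E j\<in>{1..l}. Zstar \<eta> - {\<lambda>_. 0})"
  shows
    "(nonresonant_discrete \<eta> \<Theta> l \<rho> \<longrightarrow>
       (\<exists>C N\<^sub>0. \<forall>N::nat. N > 0 \<and> N \<ge> N\<^sub>0 \<longrightarrow> (\<forall>\<theta>\<in>space torus.
          norm (DMW l \<rho> F N \<theta> - seqprod (\<lambda>j. strong_integral torus (F j)) l)
            \<le> C / real N ^ m))) \<and>
     (nonresonant_continuous \<eta> \<Theta> l \<rho> \<longrightarrow>
       (\<exists>C T\<^sub>0. \<forall>T::real. T > 0 \<and> T \<ge> T\<^sub>0 \<longrightarrow> (\<forall>\<theta>\<in>space torus.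
          norm (CMW l \<rho> F T \<theta> - seqprod (\<lambda>j. strong_integral torus (F j)) l)
            \<le> C / T ^ m)))"
proof -
  let ?J = "joint_vectors \<eta> l" and ?z = "zero_joint l"
  let ?\<alpha> = "\<lambda>k. joint_dot l k \<rho>" and ?\<beta> = "\<lambda>\<theta> k. joint_dot l k (\<lambda>_. \<theta>)"
  let ?r = "\<lambda>k. \<Theta> (joint_norm \<eta> l k) ^ m"
  define Q where "Q = (\<Sum>\<^sub>\<infinity>k\<in>?J - {?z}. ?r k * norm (joint_coeff l F k))"
  have \<Delta>: "\<And>j. j \<in> {1..l} \<Longrightarrow> approximation_function (\<Delta> j)"
    and F: "\<And>j. j \<in> {1..l} \<Longrightarrow> F j \<in> fourier_class \<eta> (\<Delta> j)" using assms by blast+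
  note coeff = summable_joint_coeff[OF \<open>approximation_function \<Theta>\<close> \<Delta> F assms(8)]
  note orbit = orbit_has_sum[OF \<open>1 \<le> l\<close> F coeff(1)]
  have dot0: "joint_dot l ?z x = 0" for x
    by (simp add: joint_dot_def zero_joint_def kdot_zero)
  have error: "norm (S - seqprod (\<lambda>j. strong_integral torus (F j)) l) \<le> E * Q"
    if "((\<lambda>k. W k *\<^sub>C cis (2 * pi * ?\<beta> \<theta> k) *\<^sub>C joint_coeff l F k) has_sum S) ?J"
      "W ?z = 1" "\<And>k. k \<in> ?J - {?z} \<Longrightarrow> cmod (W k) \<le> E * ?r k" for W S E \<theta>
    unfolding Q_def joint_coeff_zero[symmetric]
    by (rule multiplier_error_bound[OF that(1) zero_joint_in that(2) _ _ that(3) coeff(2)])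
      (simp_all add: dot0)
  have \<Theta>1: "1 \<le> \<Theta> (joint_norm \<eta> l k)" if "k \<in> ?J - {?z}" for k
    by (rule approximation_functionD(1)[OF \<open>approximation_function \<Theta>\<close> joint_vectors_nonzero(2)[OF that]])
  show ?thesis
  proof (intro conjI impI)
    assume "nonresonant_discrete \<eta> \<Theta> l \<rho>"
    then obtain \<gamma> where \<gamma>: "\<gamma> > 0"
      "\<And>k n. k \<in> ?J - {?z} \<Longrightarrow> \<bar>?\<alpha> k - of_int n\<bar> > \<gamma> / \<Theta> (joint_norm \<eta> l k)"
      unfolding nonresonant_discrete_def using joint_vectors_nonzero(1) by (metis DiffD1)
    obtain C where C: "\<And>N \<alpha> \<delta>. N \<ge> 3 \<Longrightarrow> \<delta> > 0 \<Longrightarrow> (\<And>n::int. \<bar>\<alpha> - of_int n\<bar> \<ge> \<delta>) \<Longrightarrow>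
       cmod (discrete_kernel N \<alpha>) \<le> C / real N ^ m * (1 / \<delta>) ^ m"
      using discrete_kernel_bound[of m] by metis
    \<comment> \<open>\<open>N \<ge> 3\<close> makes the normalising sum nonzero.\<close>
    have "norm (DMW l \<rho> F N \<theta> - seqprod (\<lambda>j. strong_integral torus (F j)) l) \<le> (C / \<gamma> ^ m * Q) / real N ^ m"
      if "N \<ge> 3" for N \<theta>
    proof -
      have "norm (DMW l \<rho> F N \<theta> - seqprod (\<lambda>j. strong_integral torus (F j)) l) \<le> (C / \<gamma> ^ m / real N ^ m) * Q"
        unfolding DMW_def
      proof (rule error[OF discrete_average_has_sum[OF orbit(1)]])
        show "discrete_kernel N (?\<alpha> ?z) = 1" using discrete_kernel_0[OF that] by (simp add: dot0)
        fix k assume k: "k \<in> ?J - {?z}"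
        have "cmod (discrete_kernel N (?\<alpha> k)) \<le> C / real N ^ m * (1 / (\<gamma> / \<Theta> (joint_norm \<eta> l k))) ^ m"
          by (rule C[OF that]) (use \<gamma> \<Theta>1[OF k] k in \<open>auto intro: less_imp_le\<close>)
        then show "cmod (discrete_kernel N (?\<alpha> k)) \<le> C / \<gamma> ^ m / real N ^ m * ?r k"
          by (simp add: power_divide mult.commute)
      qed auto
      then show ?thesis by simp
    qed
    then show "\<exists>C N\<^sub>0. \<forall>N::nat. N > 0 \<and> N \<ge> N\<^sub>0 \<longrightarrow> (\<forall>\<theta>\<in>space torus.
          norm (DMW l \<rho> F N \<theta> - seqprod (\<lambda>j. strong_integral torus (F j)) l) \<le> C / real N ^ m)"
      by blast
  next
    assume "nonresonant_continuous \<eta> \<Theta> l \<rho>"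
    then obtain \<gamma> where \<gamma>: "\<gamma> > 0"
      "\<And>k. k \<in> ?J - {?z} \<Longrightarrow> \<bar>?\<alpha> k\<bar> > \<gamma> / \<Theta> (joint_norm \<eta> l k)"
      unfolding nonresonant_continuous_def using joint_vectors_nonzero(1) by (metis DiffD1)
    obtain C where C: "\<And>T \<alpha> \<delta>. T > 0 \<Longrightarrow> \<delta> > 0 \<Longrightarrow> \<bar>\<alpha>\<bar> \<ge> \<delta> \<Longrightarrow>
       cmod (continuous_kernel T \<alpha>) \<le> C / T ^ m * (1 / \<delta>) ^ m"
      using continuous_kernel_bound[of m] by metis
    have "norm (CMW l \<rho> F T \<theta> - seqprod (\<lambda>j. strong_integral torus (F j)) l) \<le> (C / \<gamma> ^ m * Q) / T ^ m"
      if "T > 0" for T \<theta>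
    proof -
      have "norm (CMW l \<rho> F T \<theta> - seqprod (\<lambda>j. strong_integral torus (F j)) l) \<le> (C / \<gamma> ^ m / T ^ m) * Q"
        unfolding CMW_def
      proof (rule error[OF continuous_average_has_sum[OF orbit]])
        show "continuous_kernel T (?\<alpha> ?z) = 1" using continuous_kernel_0[OF that] by (simp add: dot0)
        fix k assume k: "k \<in> ?J - {?z}"
        have "cmod (continuous_kernel T (?\<alpha> k)) \<le> C / T ^ m * (1 / (\<gamma> / \<Theta> (joint_norm \<eta> l k))) ^ m"
          by (rule C[OF that]) (use \<gamma> \<Theta>1[OF k] k in \<open>auto intro: less_imp_le\<close>)
        then show "cmod (continuous_kernel T (?\<alpha> k)) \<le> C / \<gamma> ^ m / T ^ m * ?r k"
          by (simp add: power_divide mult.commute)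
      qed auto
      then show ?thesis by simp
    qed
    then show "\<exists>C T\<^sub>0. \<forall>T::real. T > 0 \<and> T \<ge> T\<^sub>0 \<longrightarrow> (\<forall>\<theta>\<in>space torus.
          norm (CMW l \<rho> F T \<theta> - seqprod (\<lambda>j. strong_integral torus (F j)) l) \<le> C / T ^ m)"
      by blast
  qed
qed

end
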